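(* At most one element of the infinite set of real numbers $$\{\gamma\}\cup\{\psi(r/n) : n,r\in\mathbb{N},\ n>1,\ 1\le r<n,\ (r,n)=1\}$$ is algebraic (over $\mathbb{Q}$).
   Context: $\gamma$ denotes Euler's constant. For a real number $x\neq 0,-1,-2,\ldots$, the digamma function $\psi(x)$ is the logarithmic derivative of the gamma function, given by $-\psi(x)=\gamma+\frac1x+\sum_{m=1}^{\infty}\left(\frac{1}{m+x}-\frac1m\right)$. $(r,n)$ denotes the greatest common divisor. *)

theory Defs
  imports "HOL-Analysis.Analysis" "HOL-Computational_Algebra.Polynomial" "HOL-Real_Asymp.Real_Asymp"
begin

text \<open>
  The library's \<open>Digamma\<close> (that is, \<open>Polygamma 0\<close>) is the function \<open>\<psi>\<close>: the two lemmas
  below are the two descriptions of \<open>\<psi>\<close> that serve as its definition.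
\<close>

lemma Digamma_eq_log_deriv_Gamma:
  fixes x :: real
  assumes "x \<notin> \<int>\<^sub>\<le>\<^sub>0"
  shows "Digamma x = deriv Gamma x / Gamma x"
proof -
  have "deriv Gamma x = Gamma x * Digamma x"
    using assms by (intro DERIV_imp_deriv has_field_derivative_Gamma)
  then show ?thesis
    using assms by (simp add: Gamma_eq_zero_iff)
qed

lemma minus_Digamma_series:
  fixes x :: real
  assumes "x \<notin> \<int>\<^sub>\<le>\<^sub>0"
  shows "summable (\<lambda>m. 1 / (real (Suc m) + x) - 1 / real (Suc m))"
    and "- Digamma x = euler_mascheroni + 1 / x +
           (\<Sum>m. 1 / (real (Suc m) + x) - 1 / real (Suc m))"
proof -
  have x: "x \<noteq> 0" using assms by auto
  let ?f = "\<lambda>k. inverse (real (Suc k)) - inverse (x + real k)"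
  have tail: "?f sums (Digamma x + euler_mascheroni)"
    using summable_Digamma[OF x] by (simp add: Digamma_def summable_sums)
  have "(\<lambda>k. inverse (x + real k) - inverse (x + real (Suc k))) sums (inverse (x + real 0) - 0)"
    by (rule telescope_sums') real_asymp
  from sums_minus[OF sums_add[OF tail this]]
  have "(\<lambda>m. 1 / (real (Suc m) + x) - 1 / real (Suc m)) sums
          (- (Digamma x + euler_mascheroni + 1 / x))"
    by (simp add: inverse_eq_divide add_ac)
  then show "summable (\<lambda>m. 1 / (real (Suc m) + x) - 1 / real (Suc m))"
    and "- Digamma x = euler_mascheroni + 1 / x +
           (\<Sum>m. 1 / (real (Suc m) + x) - 1 / real (Suc m))"
    by (auto simp: sums_iff)
qed

definition gamma_digamma_values :: "real set" where
  "gamma_digamma_values = {euler_mascheroni} \<union>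
     {Digamma (real r / real n) | (n::nat) (r::nat). n > 1 \<and> 1 \<le> r \<and> r < n \<and> coprime r n}"

end

theory Submission
  imports Defs "HOL-Complex_Analysis.Complex_Analysis"
begin

text \<open>
  Gauss' formula expresses \<open>\<psi>(r/n) + \<gamma>\<close> as a linear form with algebraic coefficients in logarithms of
  the algebraic integers \<open>1 - \<zeta>\<close>, where \<open>\<zeta> \<noteq> 1\<close> runs through the \<open>n\<close>-th roots of unity. If two of the
  given numbers were algebraic, then their difference (or sum, if one of them is \<open>\<gamma>\<close>) would be such a
  form with an algebraic value, hence zero by Baker's theorem; this contradicts the strict
  monotonicity of \<open>\<psi>\<close> and \<open>\<psi>(1) = -\<gamma>\<close>.

  For Baker's theorem, suppose that \<open>\<Sum> \<beta> x * x \<noteq> 0\<close> is algebraic, where the \<open>exp x\<close> are algebraic. Siegel's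
  lemma yields a polynomial in \<open>\<Sum> \<beta> x * z x\<close> and the \<open>exp (z x)\<close> all of whose derivatives of small order vanish at
  the first few integer multiples of the point \<open>z x = x\<close>. The maximum principle and a Liouville-type lower bound
  propagate these zeros to more and more multiples, at the price of lowering the order, until there are so many that
  the exponential polynomial must vanish identically.
\<close>

subsection \<open>Siegel's lemma and a Liouville inequality\<close>

text \<open>The auxiliary function depends on \<open>n = card X\<close> variables but is built from
  \<open>n + 1\<close> functions, the \<open>exp (z x)\<close> and the linear form. This surplus of
  one pays for zeros of high order. At an integer multiple \<open>l\<close> of the base point the
  linear form takes the value \<open>l * form\<close>, algebraic by assumption, and a partial
  derivative brings in only the algebraic \<open>\<beta> x\<close>, never the \<open>x\<close>
  themselves. Differentiation along the complex line through the base point does bring in the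
  \<open>x\<close>. Vanishing is therefore recorded for mixed partial derivatives, while the maximum
  principle is applied to their restrictions to the line; this passage is what uses up part of the
  order in every step. The number 2 \<pi> i needs special care: a multiplicative relation between
  the \<open>exp x\<close> is a linear relation between the \<open>x\<close> only up to a multiple
  of 2 \<pi> i. Only logarithms of algebraic integers are treated. The powers
  \<open>exp x ^ l\<close> then create no denominators, and the numbers 1 - \<zeta> are
  covered.\<close>

lemma siegel_lemma:
  fixes c :: "'e \<Rightarrow> 'u \<Rightarrow> int"
  assumes E: "finite E" and U: "finite U" "U \<noteq> {}" and card: "2 * card E \<le> card U"
    and bound: "\<And>e u. e \<in> E \<Longrightarrow> u \<in> U \<Longrightarrow> \<bar>c e u\<bar> \<le> int B"
  obtains x where "\<exists>u\<in>U. x u \<noteq> 0" "\<And>u. u \<in> U \<Longrightarrow> \<bar>x u\<bar> \<le> int (2 * card U * B + 1)"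
    "\<And>e. e \<in> E \<Longrightarrow> (\<Sum>u\<in>U. c e u * x u) = 0"
proof -
  \<comment> \<open>This choice gives \<open>2 * card U * B * X + 1 < (X + 1)^2\<close>. With at
    least two unknowns per equation, the box \<open>S\<close> then has more points than
    \<open>T\<close>, and the difference of two points with the same image is a solution.\<close>
  define X where "X = 2 * card U * B + 1"
  define S where "S = PiE U (\<lambda>_. {0..int X})"
  define T where "T = PiE E (\<lambda>_. {-int (card U * B * X)..int (card U * B * X)})"
  define \<Phi> where "\<Phi> x = restrict (\<lambda>e. \<Sum>u\<in>U. c e u * x u) E" for x
  have sub: "\<Phi> ` S \<subseteq> T"
  proof safe
    fix x assume x: "x \<in> S"
    have "\<bar>\<Sum>u\<in>U. c e u * x u\<bar> \<le> int (card U * B * X)" if e: "e \<in> E" for e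
    proof -
      have "\<bar>\<Sum>u\<in>U. c e u * x u\<bar> \<le> (\<Sum>u\<in>U. \<bar>c e u\<bar> * \<bar>x u\<bar>)"
        by (rule order.trans[OF sum_abs]) (simp add: abs_mult)
      also have "\<dots> \<le> (\<Sum>u\<in>U. int B * int X)"
        using x bound[OF e] by (intro sum_mono mult_mono) (auto simp: S_def PiE_iff)
      finally show ?thesis by (simp add: mult.assoc)
    qed
    then show "\<Phi> x \<in> T" by (auto simp: T_def \<Phi>_def abs_le_iff minus_le_iff)
  qed
  have cU: "card U > 0" using U by (simp add: card_gt_0_iff)
  have cS: "card S = (X + 1) ^ card U"
    using U by (simp add: S_def card_PiE nat_add_distrib)
  have cT: "card T = (2 * card U * B * X + 1) ^ card E"
    using E by (simp add: T_def card_PiE nat_add_distrib nat_mult_distrib algebra_simps)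
  have "card T < card S"
  proof (cases "card E = 0")
    case True
    then show ?thesis using cU cS cT one_less_power[of "X + 1" "card U"] by (simp add: X_def)
  next
    case False
    have "2 * card U * B * X + 1 < (X + 1)^2"
    proof -
      have "2 * card U * B * X \<le> X * X" unfolding X_def by (intro mult_right_mono) auto
      then show ?thesis by (simp add: power2_eq_square X_def)
    qed
    then have "(2 * card U * B * X + 1) ^ card E < ((X + 1)^2) ^ card E"
      using False by (intro power_strict_mono) auto
    also have "\<dots> = (X + 1) ^ (2 * card E)" by (simp add: power_mult)
    also have "\<dots> \<le> (X + 1) ^ card U" using card by (intro power_increasing) auto
    finally show ?thesis by (simp add: cS cT)
  qed
  moreover have "finite T" using E by (auto simp: T_def intro!: finite_PiE)
  ultimately have "\<not> inj_on \<Phi> S"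
    using sub card_inj_on_le by (metis linorder_not_le)
  then obtain x y where xy: "x \<in> S" "y \<in> S" "x \<noteq> y" "\<Phi> x = \<Phi> y" by (auto simp: inj_on_def)
  show thesis
  proof (rule that[of "\<lambda>u. x u - y u"])
    show "\<exists>u\<in>U. x u - y u \<noteq> 0"
    proof (rule ccontr)
      assume "\<not> ?thesis"
      then have "x = y" using xy(1,2) unfolding S_def by (intro PiE_ext) auto
      with xy(3) show False by simp
    qed
    show "\<bar>x u - y u\<bar> \<le> int (2 * card U * B + 1)" if "u \<in> U" for u
    proof -
      have "x u \<in> {0..int X}" "y u \<in> {0..int X}" using xy(1,2) that by (auto simp: S_def)
      then show ?thesis unfolding X_def by auto
    qed
    show "(\<Sum>u\<in>U. c e u * (x u - y u)) = 0" if "e \<in> E" for e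
      using fun_cong[OF xy(4), of e] that by (simp add: \<Phi>_def algebra_simps sum_subtractf)
  qed
qed

text \<open>Multiplication by \<open>x\<close> maps the integer span of \<open>V\<close> to itself, with an integer matrix whose
  row sums are at most \<open>b\<close>. Since \<open>b\<close> is submultiplicative and bounds \<open>x\<close> together with its conjugates,
  it plays the role of a height, and no number field has to be fixed.\<close>

definition zrep :: "complex set \<Rightarrow> nat \<Rightarrow> complex \<Rightarrow> bool" where
  "zrep V b x \<longleftrightarrow> (\<exists>M :: complex \<Rightarrow> complex \<Rightarrow> int.
     (\<forall>v\<in>V. x * v = (\<Sum>w\<in>V. of_int (M v w) * w) \<and> (\<Sum>w\<in>V. \<bar>M v w\<bar>) \<le> int b))"

lemma zrep_mono: "zrep V a x \<Longrightarrow> a \<le> b \<Longrightarrow> zrep V b x"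
  unfolding zrep_def by (meson of_nat_mono order_trans)

lemma zrep_of_int:
  assumes "finite V" shows "zrep V (nat \<bar>k\<bar>) (of_int k)"
proof -
  have "of_int k * v = (\<Sum>w\<in>V. of_int (if w = v then k else 0) * w) \<and>
      (\<Sum>w\<in>V. \<bar>if w = v then k else 0\<bar>) \<le> int (nat \<bar>k\<bar>)" if "v \<in> V" for v
    using assms that by (simp add: if_distrib[of of_int] if_distrib[of abs] if_distribR sum.delta
      if_distrib[of "\<lambda>x. x * _"] cong: if_cong)
  then show ?thesis unfolding zrep_def by (intro exI[of _ "\<lambda>v w. if w = v then k else 0"]) blast
qed

lemma zrep_of_nat: "finite V \<Longrightarrow> zrep V k (of_nat k)"
  using zrep_of_int[of V "int k"] by simp

lemma zrep_add:
  assumes "zrep V a x" "zrep V b y" shows "zrep V (a + b) (x + y)"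
proof -
  obtain M where M: "x * v = (\<Sum>w\<in>V. of_int (M v w) * w) \<and> (\<Sum>w\<in>V. \<bar>M v w\<bar>) \<le> int a" if "v \<in> V" for v
    using assms(1) unfolding zrep_def by blast
  obtain N where N: "y * v = (\<Sum>w\<in>V. of_int (N v w) * w) \<and> (\<Sum>w\<in>V. \<bar>N v w\<bar>) \<le> int b" if "v \<in> V" for v
    using assms(2) unfolding zrep_def by blast
  note * = M N
  have "(x + y) * v = (\<Sum>w\<in>V. of_int (M v w + N v w) * w) \<and> (\<Sum>w\<in>V. \<bar>M v w + N v w\<bar>) \<le> int (a + b)"
    if "v \<in> V" for v
  proof
    show "(x + y) * v = (\<Sum>w\<in>V. of_int (M v w + N v w) * w)"
      using *[OF that] by (simp add: distrib_right sum.distrib)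
    have "(\<Sum>w\<in>V. \<bar>M v w + N v w\<bar>) \<le> (\<Sum>w\<in>V. \<bar>M v w\<bar> + \<bar>N v w\<bar>)" by (intro sum_mono) auto
    then show "(\<Sum>w\<in>V. \<bar>M v w + N v w\<bar>) \<le> int (a + b)" using *[OF that] by (simp add: sum.distrib)
  qed
  then show ?thesis unfolding zrep_def by (intro exI[of _ "\<lambda>v w. M v w + N v w"]) blast
qed

lemma zrep_mult:
  assumes "zrep V a x" "zrep V b y" shows "zrep V (a * b) (x * y)"
proof -
  obtain M where M: "x * v = (\<Sum>w\<in>V. of_int (M v w) * w) \<and> (\<Sum>w\<in>V. \<bar>M v w\<bar>) \<le> int a" if "v \<in> V" for v
    using assms(1) unfolding zrep_def by blast
  obtain N where N: "y * v = (\<Sum>w\<in>V. of_int (N v w) * w) \<and> (\<Sum>w\<in>V. \<bar>N v w\<bar>) \<le> int b" if "v \<in> V" for v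
    using assms(2) unfolding zrep_def by blast
  note * = M N
  define P where "P v u = (\<Sum>w\<in>V. N v w * M w u)" for v u
  have "(x * y) * v = (\<Sum>w\<in>V. of_int (P v w) * w) \<and> (\<Sum>w\<in>V. \<bar>P v w\<bar>) \<le> int (a * b)"
    if "v \<in> V" for v
  proof
    have "(x * y) * v = (\<Sum>w\<in>V. of_int (N v w) * (x * w))"
      using *(2)[OF that] by (simp add: mult.assoc sum_distrib_left mult.left_commute)
    also have "\<dots> = (\<Sum>w\<in>V. \<Sum>u\<in>V. of_int (N v w * M w u) * u)"
      using *(1) by (intro sum.cong) (simp_all add: sum_distrib_left mult.assoc)
    also have "\<dots> = (\<Sum>u\<in>V. of_int (P v u) * u)"
      unfolding P_def by (subst sum.swap) (simp add: sum_distrib_right)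
    finally show "(x * y) * v = (\<Sum>w\<in>V. of_int (P v w) * w)" .
    have "(\<Sum>u\<in>V. \<bar>P v u\<bar>) \<le> (\<Sum>u\<in>V. \<Sum>w\<in>V. \<bar>N v w\<bar> * \<bar>M w u\<bar>)"
      unfolding P_def abs_mult[symmetric] by (intro sum_mono sum_abs)
    also have "\<dots> = (\<Sum>w\<in>V. \<bar>N v w\<bar> * (\<Sum>u\<in>V. \<bar>M w u\<bar>))"
      by (subst sum.swap) (simp add: sum_distrib_left)
    also have "\<dots> \<le> (\<Sum>w\<in>V. \<bar>N v w\<bar> * int a)" using *(1) by (intro sum_mono mult_left_mono) auto
    also have "\<dots> = (\<Sum>w\<in>V. \<bar>N v w\<bar>) * int a" by (simp add: sum_distrib_right)
    also have "\<dots> \<le> int b * int a" using *(2)[OF that] by (intro mult_right_mono) auto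
    finally show "(\<Sum>w\<in>V. \<bar>P v w\<bar>) \<le> int (a * b)" by (simp add: mult.commute)
  qed
  then show ?thesis unfolding zrep_def by (intro exI[of _ P]) blast
qed

lemma zrep_1: "finite V \<Longrightarrow> zrep V 1 1"
  using zrep_of_nat[of V 1] by simp

lemma zrep_sum:
  assumes "finite V" "\<And>i. i \<in> I \<Longrightarrow> zrep V (b i) (x i)"
  shows "zrep V (\<Sum>i\<in>I. b i) (\<Sum>i\<in>I. x i)"
  using assms(2)
proof (induction I rule: infinite_finite_induct)
  case (insert i I) then show ?case by (auto intro!: zrep_add)
qed (use zrep_of_nat[OF assms(1), of 0] in simp_all)

lemma zrep_prod:
  assumes "finite V" "\<And>i. i \<in> I \<Longrightarrow> zrep V (b i) (x i)"
  shows "zrep V (\<Prod>i\<in>I. b i) (\<Prod>i\<in>I. x i)"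
  using assms(2)
proof (induction I rule: infinite_finite_induct)
  case (insert i I) then show ?case by (auto intro!: zrep_mult)
qed (use zrep_1[OF assms(1)] in simp_all)

lemma zrep_power:
  assumes "finite V" "zrep V b x" shows "zrep V (b ^ k) (x ^ k)"
  using zrep_prod[of V "{..<k}" "\<lambda>_. b" "\<lambda>_. x"] assms by simp

text \<open>Since \<open>1 \<in> V\<close>, the matrix row at \<open>1\<close> writes
  \<open>x e u\<close> as an integer combination of \<open>V\<close> with coefficients at most
  \<open>B\<close>. Each complex equation thus follows from \<open>card V\<close> integer ones, and
  \<open>V\<close> may be linearly dependent.\<close>

lemma zrep_relations:
  assumes V: "finite V" "1 \<in> V" and E: "finite E" and U: "finite U" "U \<noteq> {}"
    and card: "2 * (card E * card V) \<le> card U"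
    and rep: "\<And>e u. e \<in> E \<Longrightarrow> u \<in> U \<Longrightarrow> zrep V B (x e u)"
  obtains q :: "'u \<Rightarrow> int" where "\<exists>u\<in>U. q u \<noteq> 0" "\<And>u. u \<in> U \<Longrightarrow> \<bar>q u\<bar> \<le> int (2 * card U * B + 1)"
    "\<And>e. e \<in> E \<Longrightarrow> (\<Sum>u\<in>U. of_int (q u) * x e u) = 0"
proof -
  have "\<exists>M. \<forall>e\<in>E. \<forall>u\<in>U. x e u = (\<Sum>w\<in>V. of_int (M e u w) * w) \<and> (\<Sum>w\<in>V. \<bar>M e u w\<bar>) \<le> int B"
  proof -
    have "\<exists>m. x e u = (\<Sum>w\<in>V. of_int (m w) * w) \<and> (\<Sum>w\<in>V. \<bar>m w\<bar>) \<le> int B" if "e \<in> E" "u \<in> U" for e u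
      using rep[OF that] V(2) unfolding zrep_def by (metis mult.right_neutral)
    then show ?thesis by metis
  qed
  then obtain M where M: "\<And>e u. e \<in> E \<Longrightarrow> u \<in> U \<Longrightarrow> x e u = (\<Sum>w\<in>V. of_int (M e u w) * w)"
      "\<And>e u. e \<in> E \<Longrightarrow> u \<in> U \<Longrightarrow> (\<Sum>w\<in>V. \<bar>M e u w\<bar>) \<le> int B" by blast
  have mb: "\<bar>M e u w\<bar> \<le> int B" if "e \<in> E" "u \<in> U" "w \<in> V" for e u w
    using M(2)[OF that(1,2)] member_le_sum[of w V "\<lambda>w. \<bar>M e u w\<bar>"] that V by simp
  obtain q where q: "\<exists>u\<in>U. q u \<noteq> 0" "\<And>u. u \<in> U \<Longrightarrow> \<bar>q u\<bar> \<le> int (2 * card U * B + 1)"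
    "\<And>e. e \<in> E \<times> V \<Longrightarrow> (\<Sum>u\<in>U. M (fst e) u (snd e) * q u) = 0"
    by (rule siegel_lemma[of "E \<times> V" U "\<lambda>e u. M (fst e) u (snd e)" B])
      (use E V U card mb in \<open>simp_all add: card_cartesian_product mem_Times_iff\<close>)
  show thesis
  proof (rule that[OF q(1,2)])
    fix e assume e: "e \<in> E"
    have "(\<Sum>u\<in>U. of_int (q u) * x e u) = (\<Sum>u\<in>U. \<Sum>w\<in>V. of_int (M e u w * q u) * w)"
      using M(1)[OF e] by (intro sum.cong) (auto simp: sum_distrib_left algebra_simps)
    also have "\<dots> = (\<Sum>w\<in>V. of_int (\<Sum>u\<in>U. M e u w * q u) * w)"
      by (subst sum.swap) (simp add: sum_distrib_right)
    also have "\<dots> = 0" using q(3)[of "(e, w)" for w] e by (intro sum.neutral) auto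
    finally show "(\<Sum>u\<in>U. of_int (q u) * x e u) = 0" .
  qed
qed

text \<open>A single equation between the powers of \<open>x\<close> is solved by Siegel's lemma.
  About twice the degree of a characteristic polynomial is the price for bounding the coefficients
  without determinants.\<close>

lemma zrep_annihilator:
  assumes V: "finite V" "1 \<in> V" and x: "zrep V b x" and b: "1 \<le> b"
  obtains q :: "nat \<Rightarrow> int" where "\<exists>i<2 * card V. q i \<noteq> 0"
    "\<And>i. i < 2 * card V \<Longrightarrow> \<bar>q i\<bar> \<le> int (5 * card V * b ^ (2 * card V))"
    "(\<Sum>i<2 * card V. of_int (q i) * x ^ i) = 0"
proof -
  let ?D = "card V"
  have D: "?D > 0" using V by (auto simp: card_gt_0_iff)
  have "zrep V (b ^ (2 * ?D)) (x ^ i)" if "i < 2 * ?D" for i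
    by (rule zrep_mono[OF zrep_power[OF V(1) x, of i]]) (use that b in \<open>auto intro: power_increasing\<close>)
  then obtain q :: "nat \<Rightarrow> int" where q: "\<exists>i\<in>{..<2 * ?D}. q i \<noteq> 0"
     "\<And>i. i \<in> {..<2 * ?D} \<Longrightarrow> \<bar>q i\<bar> \<le> int (2 * card {..<2 * ?D} * b ^ (2 * ?D) + 1)"
     "\<And>e. e \<in> {()} \<Longrightarrow> (\<Sum>i\<in>{..<2 * ?D}. of_int (q i) * x ^ i) = 0"
    using D by (rule_tac zrep_relations[of V "{()}" "{..<2 * ?D}" "b ^ (2 * ?D)" "\<lambda>_ i. x ^ i", OF V])
      (auto simp: lessThan_empty_iff)
  show thesis
  proof (rule that[of q])
    fix i assume "i < 2 * ?D"
    then have "\<bar>q i\<bar> \<le> int (2 * (2 * ?D) * b ^ (2 * ?D) + 1)" using q(2)[of i] by simp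
    also have "\<dots> \<le> int (2 * (2 * ?D) * b ^ (2 * ?D) + ?D * b ^ (2 * ?D))"
      using D b by (subst of_nat_le_iff) (simp add: Suc_le_eq)
    finally show "\<bar>q i\<bar> \<le> int (5 * ?D * b ^ (2 * ?D))" by (simp add: algebra_simps)
  qed (use q in auto)
qed

text \<open>The lowest nonzero coefficient of the annihilating polynomial is a nonzero integer, and it is
  a multiple of \<^term>\<open>x\<close> with a controlled factor.\<close>

lemma zrep_lower_bound:
  assumes V: "finite V" "1 \<in> V" and x: "zrep V b x" and b: "1 \<le> b" and nz: "x \<noteq> 0"
  shows "1 \<le> norm x * real (10 * card V ^ 2 * b ^ (2 * card V))"
proof -
  let ?D = "card V" let ?Q = "real (5 * ?D * b ^ (2 * ?D))"
  have D: "?D > 0" using V by (auto simp: card_gt_0_iff)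
  from zrep_annihilator[OF V x b] obtain q :: "nat \<Rightarrow> int" where
    q: "\<exists>i<2 * ?D. q i \<noteq> 0" "\<And>i. i < 2 * ?D \<Longrightarrow> \<bar>q i\<bar> \<le> int (5 * ?D * b ^ (2 * ?D))"
    "(\<Sum>i<2 * ?D. of_int (q i) * x ^ i) = 0" by blast
  define k where "k = (LEAST i. i < 2 * ?D \<and> q i \<noteq> 0)"
  have k: "k < 2 * ?D" "q k \<noteq> 0" using q(1) LeastI_ex[of "\<lambda>i. i < 2 * ?D \<and> q i \<noteq> 0"] by (auto simp: k_def)
  have kz: "q i = 0" if "i < k" for i using not_less_Least[of i "\<lambda>i. i < 2 * ?D \<and> q i \<noteq> 0"] that k by (auto simp: k_def)
  show ?thesis
  proof (cases "norm x \<le> 1")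
    case False
    have "1 \<le> real (10 * ?D ^ 2 * b ^ (2 * ?D))"
      using D b by (subst one_of_nat_le_iff) (simp add: Suc_le_eq)
    then show ?thesis using False mult_mono[of 1 "norm x" 1 "real (10 * ?D ^ 2 * b ^ (2 * ?D))"] by simp
  next
    case True
    have "(\<Sum>i<2 * ?D. of_int (q i) * x ^ i) = (\<Sum>i\<in>{k..<2 * ?D}. of_int (q i) * x ^ i)"
      using kz by (intro sum.mono_neutral_right) auto
    also have "\<dots> = x ^ k * (\<Sum>i\<in>{k..<2 * ?D}. of_int (q i) * x ^ (i - k))"
      by (simp add: sum_distrib_left mult.left_commute flip: power_add)
    finally have "(\<Sum>i\<in>{k..<2 * ?D}. of_int (q i) * x ^ (i - k)) = 0" using q(3) nz by simp
    moreover have "{k..<2 * ?D} = insert k {k<..<2 * ?D}" using k by auto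
    ultimately have "of_int (q k) = - (\<Sum>i\<in>{k<..<2 * ?D}. of_int (q i) * x ^ (i - k))"
      by (simp add: add_eq_0_iff)
    then have "norm (of_int (q k) :: complex) = norm (\<Sum>i\<in>{k<..<2 * ?D}. of_int (q i) * x ^ (i - k))" by simp
    also have "\<dots> \<le> (\<Sum>i\<in>{k<..<2 * ?D}. ?Q * norm x)"
    proof (intro sum_norm_le)
      fix i assume i: "i \<in> {k<..<2 * ?D}"
      have "norm x ^ (i - k) \<le> norm x ^ 1" using i True by (intro power_decreasing) auto
      moreover have "\<bar>of_int (q i) :: real\<bar> \<le> ?Q" using q(2)[of i] i by (metis greaterThanLessThan_iff of_int_abs of_int_of_nat_eq of_int_le_iff)
      ultimately show "norm (of_int (q i) * x ^ (i - k)) \<le> ?Q * norm x"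
        by (simp add: norm_mult norm_power mult_mono)
    qed
    also have "\<dots> = real (2 * ?D - Suc k) * ?Q * norm x" by simp
    also have "\<dots> \<le> real (2 * ?D) * ?Q * norm x" by (intro mult_right_mono) auto
    finally have "norm (of_int (q k) :: complex) \<le> norm x * real (10 * ?D ^ 2 * b ^ (2 * ?D))"
      by (simp add: power2_eq_square mult_ac)
    moreover have "1 \<le> norm (of_int (q k) :: complex)" using k(2) by (simp flip: of_int_abs)
    ultimately show ?thesis by linarith
  qed
qed

subsection \<open>Algebraic numbers\<close>

lemma coeff_sum_monom:
  "coeff (\<Sum>i<n. monom (a i) i) j = (if j < n then a j else 0)"
  by (simp add: coeff_sum)

text \<open>Integrality is handled as a rule that rewrites the power \<open>d\<close> by lower ones;
  this is the form in which the stable module below is closed up.\<close>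

lemma algebraic_intI_relation:
  fixes y :: "'a :: field_char_0"
  assumes "y ^ d = (\<Sum>i<d. of_int (k i) * y ^ i)"
  shows "algebraic_int y"
proof (rule algebraic_int.intros)
  define p where "p = monom 1 d - (\<Sum>i<d. monom (of_int (k i) :: 'a) i)"
  have c: "coeff p j = (if j = d then 1 else if j < d then - of_int (k j) else 0)" for j
    by (auto simp: p_def coeff_sum_monom coeff_monom)
  have "degree p = d" by (intro antisym degree_le le_degree) (auto simp: c)
  then show "lead_coeff p = 1" by (simp add: c)
  show "\<forall>i. coeff p i \<in> \<int>" by (simp add: c)
  show "poly p y = 0" using assms by (simp add: p_def poly_sum poly_monom)
qed

lemma algebraic_intE_relation:
  fixes y :: "'a :: field_char_0"
  assumes "algebraic_int y"
  obtains d k where "y ^ d = (\<Sum>i<d. of_int (k i) * y ^ i)"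
proof -
  from assms obtain p where p: "poly (map_poly of_int p) y = 0" "lead_coeff p = 1"
    by (auto simp: algebraic_int_altdef_ipoly)
  have "0 = (\<Sum>i\<le>degree p. of_int (coeff p i) * y ^ i)"
    using p(1) by (simp add: poly_altdef degree_map_poly coeff_map_poly)
  also have "{..degree p} = insert (degree p) {..<degree p}" by auto
  also have "(\<Sum>i\<in>\<dots>. of_int (coeff p i) * y ^ i) = y ^ degree p + (\<Sum>i<degree p. of_int (coeff p i) * y ^ i)"
    using p(2) by simp
  finally have "y ^ degree p = (\<Sum>i<degree p. of_int (- coeff p i) * y ^ i)"
    by (simp add: sum_negf eq_neg_iff_add_eq_0)
  then show thesis by (rule that)
qed

text \<open>With \<open>c\<close> the leading coefficient and \<open>d\<close> the degree of an
  integer polynomial for \<open>x\<close>, multiplication by \<open>c ^ (d - 1)\<close> turns the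
  relation into a monic one for \<open>c * x\<close>.\<close>

lemma algebraic_imp_multiple_algebraic_int:
  fixes x :: "'a :: field_char_0"
  assumes "algebraic x"
  obtains c :: int where "c \<noteq> 0" "algebraic_int (of_int c * x)"
proof -
  from assms obtain p where p: "p \<noteq> 0" "poly (map_poly of_int p) x = 0" by (erule algebraicE')
  define d where "d = degree p"
  define c where "c = lead_coeff p"
  have c: "c \<noteq> 0" using p(1) by (simp add: c_def)
  have "d \<noteq> 0"
  proof
    assume "d = 0"
    then obtain a where "p = [:a:]" unfolding d_def using degree_eq_zeroE by blast
    then show False using p by (auto simp: map_poly_pCons)
  qed
  have "0 = (\<Sum>i\<le>d. of_int (coeff p i) * x ^ i)"
    using p(2) by (simp add: poly_altdef degree_map_poly coeff_map_poly d_def)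
  also have "{..d} = insert d {..<d}" by auto
  also have "(\<Sum>i\<in>\<dots>. of_int (coeff p i) * x ^ i) = of_int c * x ^ d + (\<Sum>i<d. of_int (coeff p i) * x ^ i)"
    by (simp add: c_def d_def)
  finally have eq: "of_int c * x ^ d = - (\<Sum>i<d. of_int (coeff p i) * x ^ i)"
    by (simp add: eq_neg_iff_add_eq_0)
  have "(of_int c * x) ^ d = of_int c ^ (d - 1) * (of_int c * x ^ d)"
    using \<open>d \<noteq> 0\<close> by (cases d) (simp_all add: power_mult_distrib mult_ac)
  also have "\<dots> = (\<Sum>i<d. of_int (- coeff p i * c ^ (d - 1 - i)) * (of_int c * x) ^ i)"
    unfolding eq sum_negf[symmetric] sum_distrib_left
  proof (intro sum.cong refl)
    fix i assume "i \<in> {..<d}"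
    then have "(of_int c :: 'a) ^ (d - 1) = of_int c ^ (d - 1 - i) * of_int c ^ i"
      by (simp flip: power_add)
    then show "of_int c ^ (d - 1) * - (of_int (coeff p i) * x ^ i) =
        of_int (- coeff p i * c ^ (d - 1 - i)) * (of_int c * x) ^ i"
      by (simp add: power_mult_distrib)
  qed
  finally show thesis by (intro that[OF c] algebraic_intI_relation)
qed

text \<open>The elements are adjoined one at a time. The products \<open>v * \<theta> ^ e\<close>
  with \<open>e < d\<close> span a module stable under \<open>\<theta>\<close>, whose monic relation
  rewrites \<open>\<theta> ^ d\<close>, and still stable under the earlier elements, which act on
  the factor \<open>v\<close> alone.\<close>

lemma exists_zrep_module:
  assumes "finite \<Theta>" "\<And>\<theta>. \<theta> \<in> \<Theta> \<Longrightarrow> algebraic_int \<theta>"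
  shows "\<exists>V. finite V \<and> 1 \<in> V \<and> (\<forall>\<theta>\<in>\<Theta>. \<exists>b. zrep V b \<theta>)"
proof -
  define Z where "Z V = {\<Sum>w\<in>V. of_int (c w) * w | c. True}" for V :: "complex set"
  have Z_add: "x + y \<in> Z V" if xy: "x \<in> Z V" "y \<in> Z V" for x y V
  proof -
    from xy obtain c d where "x = (\<Sum>w\<in>V. of_int (c w) * w)" "y = (\<Sum>w\<in>V. of_int (d w) * w)" by (auto simp: Z_def)
    then have "x + y = (\<Sum>w\<in>V. of_int (c w + d w) * w)" by (simp add: distrib_right sum.distrib)
    then show ?thesis unfolding Z_def by (intro CollectI exI conjI TrueI)
  qed
  have Z_mult: "of_int k * x \<in> Z V" if x: "x \<in> Z V" for k x V
  proof -
    from x obtain c where "x = (\<Sum>w\<in>V. of_int (c w) * w)" by (auto simp: Z_def)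
    then have "of_int k * x = (\<Sum>w\<in>V. of_int (k * c w) * w)" by (simp add: sum_distrib_left mult.assoc)
    then show ?thesis unfolding Z_def by (intro CollectI exI conjI TrueI)
  qed
  have Z_base: "v \<in> Z V" if "finite V" "v \<in> V" for v V
  proof -
    have "v = (\<Sum>w\<in>V. of_int (if w = v then 1 else 0) * w)"
      using that by (simp add: if_distrib[of of_int] if_distrib[of "\<lambda>x. x * _"] sum.delta cong: if_cong)
    then show ?thesis unfolding Z_def by (intro CollectI exI conjI TrueI)
  qed
  have Z_sum: "(\<Sum>i\<in>I. f i) \<in> Z V" if "\<And>i. i \<in> I \<Longrightarrow> f i \<in> Z V" for f :: "'i \<Rightarrow> complex" and I V
    using that
  proof (induction I rule: infinite_finite_induct)
    case (insert i I) then show ?case by (auto intro: Z_add)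
  qed (auto simp: Z_def intro!: exI[of _ "\<lambda>_. 0"])
  have rep: "\<exists>b. zrep V b x" if V: "finite V" and x: "\<And>v. v \<in> V \<Longrightarrow> x * v \<in> Z V" for V x
  proof -
    from x have "\<forall>v\<in>V. \<exists>c. x * v = (\<Sum>w\<in>V. of_int (c w) * w)" by (auto simp: Z_def)
    then obtain M where M: "\<And>v. v \<in> V \<Longrightarrow> x * v = (\<Sum>w\<in>V. of_int (M v w) * w)" by metis
    have "(\<Sum>w\<in>V. \<bar>M v w\<bar>) \<le> int (nat (\<Sum>v\<in>V. \<Sum>w\<in>V. \<bar>M v w\<bar>))" if "v \<in> V" for v
      using member_le_sum[of v V "\<lambda>v. \<Sum>w\<in>V. \<bar>M v w\<bar>"] V that by (simp add: sum_nonneg)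
    with M show ?thesis unfolding zrep_def by blast
  qed
  have "\<exists>V. finite V \<and> 1 \<in> V \<and> (\<forall>\<theta>\<in>\<Theta>. \<forall>v\<in>V. \<theta> * v \<in> Z V)"
    using assms
  proof (induction \<Theta> rule: finite_induct)
    case empty
    show ?case by (intro exI[of _ "{1}"]) simp
  next
    case (insert \<theta> \<Theta>)
    then obtain V where V: "finite V" "1 \<in> V" "\<And>\<eta> v. \<eta> \<in> \<Theta> \<Longrightarrow> v \<in> V \<Longrightarrow> \<eta> * v \<in> Z V" by auto
    from insert.prems have "algebraic_int \<theta>" by simp
    then obtain d k where dk: "\<theta> ^ d = (\<Sum>i<d. of_int (k i) * \<theta> ^ i)" by (rule algebraic_intE_relation)
    have "d \<noteq> 0" using dk by (cases d) auto
    define V' where "V' = (\<lambda>(v, e). v * \<theta> ^ e) ` (V \<times> {..<d})"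
    have V': "v * \<theta> ^ e \<in> V'" if "v \<in> V" "e < d" for v e using that by (auto simp: V'_def)
    have fin: "finite V'" using V(1) by (simp add: V'_def)
    have "1 \<in> V'" using V'[of 1 0] V(2) \<open>d \<noteq> 0\<close> by simp
    moreover have "\<theta> * u \<in> Z V'" if u: "u \<in> V'" for u
    proof -
      from u obtain v e where ve: "v \<in> V" "e < d" "u = v * \<theta> ^ e" by (auto simp: V'_def)
      show ?thesis
      proof (cases "Suc e < d")
        case True
        then have "\<theta> * u \<in> V'" using V'[OF ve(1) True] ve(3) by (simp add: mult_ac)
        then show ?thesis by (rule Z_base[OF fin])
      next
        case False
        then have "d = Suc e" using ve(2) by simp
        then have "\<theta> * u = v * \<theta> ^ d" using ve(3) by (simp add: mult_ac)
        also have "\<dots> = (\<Sum>i<d. of_int (k i) * (v * \<theta> ^ i))" unfolding dk by (simp add: sum_distrib_left mult_ac)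
        also have "\<dots> \<in> Z V'" by (intro Z_sum Z_mult Z_base[OF fin] V' ve) simp
        finally show ?thesis .
      qed
    qed
    moreover have "\<eta> * u \<in> Z V'" if \<eta>: "\<eta> \<in> \<Theta>" and u: "u \<in> V'" for \<eta> u
    proof -
      from u obtain v e where ve: "v \<in> V" "e < d" "u = v * \<theta> ^ e" by (auto simp: V'_def)
      from V(3)[OF \<eta> ve(1)] obtain c where c: "\<eta> * v = (\<Sum>w\<in>V. of_int (c w) * w)" by (auto simp: Z_def)
      have "\<eta> * u = (\<Sum>w\<in>V. of_int (c w) * (w * \<theta> ^ e))"
        using c by (simp add: ve(3) sum_distrib_right mult.assoc[symmetric])
      also have "\<dots> \<in> Z V'" by (intro Z_sum Z_mult Z_base[OF fin] V' ve)
      finally show ?thesis .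
    qed
    ultimately show ?case using fin by blast
  qed
  then show ?thesis using rep by meson
qed

text \<open>The converse passage from modules to algebraicity, from which the closure properties of
  algebraic numbers follow. Scaling coefficient \<open>i\<close> by \<open>k ^ i\<close> turns an
  annihilator of \<open>k * z\<close> into one of \<open>z\<close>.\<close>

lemma zrep_imp_algebraic:
  assumes V: "finite V" "1 \<in> V" and rep: "zrep V b (of_int k * z)" and k: "k \<noteq> 0"
  shows "algebraic z"
proof -
  have "zrep V (b + 1) (of_int k * z)" using rep by (rule zrep_mono) simp
  then obtain q :: "nat \<Rightarrow> int" where
    q: "\<exists>i<2 * card V. q i \<noteq> 0" "(\<Sum>i<2 * card V. of_int (q i) * (of_int k * z) ^ i) = 0"
    by (rule zrep_annihilator[OF V]) simp
  define p where "p = (\<Sum>i<2 * card V. monom (of_int (q i * k ^ i) :: complex) i)"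
  have c: "coeff p j = (if j < 2 * card V then of_int (q j * k ^ j) else 0)" for j
    by (simp only: p_def coeff_sum_monom)
  show ?thesis
  proof (rule algebraicI[of p])
    show "coeff p i \<in> \<int>" for i by (simp add: c)
    show "p \<noteq> 0"
    proof
      assume "p = 0"
      then have "\<forall>j<2 * card V. q j * k ^ j = 0" using c by (metis coeff_0 of_int_eq_0_iff)
      with q(1) k show False by auto
    qed
    show "poly p z = 0" using q(2) by (simp add: p_def poly_sum poly_monom power_mult_distrib mult.assoc)
  qed
qed

lemma
  fixes x y :: complex
  assumes "algebraic x" "algebraic y"
  shows algebraic_add: "algebraic (x + y)" and algebraic_mult: "algebraic (x * y)"
proof -
  obtain c :: int where c: "c \<noteq> 0" "algebraic_int (of_int c * x)"
    using assms(1) by (rule algebraic_imp_multiple_algebraic_int)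
  obtain d :: int where d: "d \<noteq> 0" "algebraic_int (of_int d * y)"
    using assms(2) by (rule algebraic_imp_multiple_algebraic_int)
  with c exists_zrep_module[of "{of_int c * x, of_int d * y}"] obtain V a b where V: "finite V" "1 \<in> V"
    and rep: "zrep V a (of_int c * x)" "zrep V b (of_int d * y)" by auto
  have "zrep V (nat \<bar>d\<bar> * a + nat \<bar>c\<bar> * b) (of_int d * (of_int c * x) + of_int c * (of_int d * y))"
    by (intro zrep_add zrep_mult zrep_of_int rep V)
  then show "algebraic (x + y)"
    by (intro zrep_imp_algebraic[OF V, of _ "c * d"]) (use c d in \<open>simp_all add: algebra_simps\<close>)
  show "algebraic (x * y)"
    by (intro zrep_imp_algebraic[OF V, of "a * b" "c * d"])
      (use c d zrep_mult[OF rep] in \<open>simp_all add: algebra_simps\<close>)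
qed

lemma algebraic_diff: "algebraic x \<Longrightarrow> algebraic y \<Longrightarrow> algebraic (x - y)" for x y :: complex
  using algebraic_add[of x "- y"] by simp

lemma algebraic_int_of_int_mult:
  fixes x :: "'a :: field_char_0"
  assumes "algebraic_int x" shows "algebraic_int (of_int c * x)"
proof -
  from assms obtain d k where dk: "x ^ d = (\<Sum>i<d. of_int (k i) * x ^ i)" by (rule algebraic_intE_relation)
  have "(of_int c * x) ^ d = (\<Sum>i<d. of_int (k i * c ^ (d - i)) * (of_int c * x) ^ i)"
    unfolding power_mult_distrib dk sum_distrib_left
    by (intro sum.cong) (auto simp: mult_ac simp flip: power_add)
  then show ?thesis by (rule algebraic_intI_relation)
qed

subsection \<open>Exponential polynomials and entire functions with many zeros\<close>

text \<open>A generalised Vandermonde argument. Subtracting \<open>E i\<close> times the sequence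
  from its shift lowers the size of the polynomial at \<open>i\<close>, enlarges no other, and costs
  one point. If all \<open>R' j\<close> vanish, then \<open>R j = 0\<close> for
  \<open>j \<noteq> i\<close> because \<open>E j \<noteq> E i\<close>, and \<open>R i\<close> is
  invariant under the shift, hence constant; the point \<open>l = 1\<close> shows that the constant
  is 0.\<close>

lemma exponential_polynomial_eq_0:
  fixes R :: "'i \<Rightarrow> complex poly" and E :: "'i \<Rightarrow> complex"
  assumes I: "finite I" and inj: "inj_on E I" and nz: "\<And>i. i \<in> I \<Longrightarrow> E i \<noteq> 0"
    and size: "(\<Sum>i\<in>I. if R i = 0 then 0 else Suc (degree (R i))) \<le> M"
    and zero: "\<And>l. 1 \<le> l \<Longrightarrow> l \<le> M \<Longrightarrow> (\<Sum>i\<in>I. poly (R i) (of_nat l) * E i ^ l) = 0"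
    and i: "i \<in> I"
  shows "R i = 0"
  using size zero i
proof (induction M arbitrary: R i)
  case 0
  then show ?case using I by (auto split: if_splits)
next
  case (Suc M)
  define sz :: "complex poly \<Rightarrow> nat" where "sz p = (if p = 0 then 0 else Suc (degree p))" for p
  show ?case
  proof (rule ccontr)
    assume Ri: "R i \<noteq> 0"
    define R' where "R' j = smult (E j) (pcompose (R j) [:1, 1:]) - smult (E i) (R j)" for j
    have top: "coeff (pcompose (R j) [:1, 1:]) (degree (R j)) = lead_coeff (R j)" for j
      using lead_coeff_comp[of "[:1, 1:]" "R j"] by (simp add: degree_pcompose)
    have deg: "degree (R' j) \<le> degree (R j)" for j
      unfolding R'_def by (intro degree_diff_le order.trans[OF degree_smult_le]) (simp_all add: degree_pcompose)
    have sz_le: "sz (R' j) \<le> sz (R j)" for j using deg[of j] by (auto simp: sz_def R'_def)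
    have sz_less: "sz (R' i) < sz (R i)"
    proof (cases "R' i = 0")
      case False
      have "coeff (R' i) (degree (R i)) = 0" by (simp add: R'_def top)
      then have "degree (R' i) \<noteq> degree (R i)" using False by (metis leading_coeff_0_iff)
      then show ?thesis using deg[of i] Ri False by (auto simp: sz_def)
    qed (use Ri in \<open>auto simp: sz_def\<close>)
    have "(\<Sum>j\<in>I. sz (R' j)) < (\<Sum>j\<in>I. sz (R j))"
      using I Suc.prems(3) sz_le sz_less by (intro sum_strict_mono_ex1) auto
    then have *: "(\<Sum>j\<in>I. if R' j = 0 then 0 else Suc (degree (R' j))) \<le> M"
      using Suc.prems(1) by (simp add: sz_def)
    have **: "(\<Sum>j\<in>I. poly (R' j) (of_nat l) * E j ^ l) = 0" if l: "1 \<le> l" "l \<le> M" for l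
    proof -
      have "(\<Sum>j\<in>I. poly (R' j) (of_nat l) * E j ^ l) =
          (\<Sum>j\<in>I. poly (R j) (of_nat (Suc l)) * E j ^ Suc l) - E i * (\<Sum>j\<in>I. poly (R j) (of_nat l) * E j ^ l)"
        by (simp add: R'_def poly_pcompose algebra_simps sum_subtractf sum_distrib_left)
      also have "\<dots> = 0" using Suc.prems(2)[of "Suc l"] Suc.prems(2)[of l] l by (auto simp del: of_nat_Suc power_Suc)
      finally show ?thesis .
    qed
    have R'0: "R' j = 0" if "j \<in> I" for j using Suc.IH[OF * ** that] by blast
    have R0: "R j = 0" if j: "j \<in> I" "j \<noteq> i" for j
    proof -
      have "E j \<noteq> E i" using inj j Suc.prems(3) by (auto dest: inj_onD)
      moreover have "coeff (R' j) (degree (R j)) = (E j - E i) * lead_coeff (R j)"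
        by (simp add: R'_def top algebra_simps)
      ultimately show ?thesis using R'0[OF j(1)] by simp
    qed
    have "degree (R i) = 0"
    proof (rule ccontr)
      assume d: "degree (R i) \<noteq> 0"
      define p where "p = pcompose (R i) [:1, 1:] - R i"
      have "smult (E i) p = 0" using R'0[OF Suc.prems(3)] by (simp add: R'_def p_def smult_diff_right)
      then have "p = 0" using nz[OF Suc.prems(3)] by simp
      then have "pcompose (R i) [:1, 1:] = R i" by (simp add: p_def)
      then have shift: "poly (R i) (z + 1) = poly (R i) z" for z
        by (metis add.commute mult.right_neutral poly_0 poly_pCons poly_pcompose mult_zero_right add.right_neutral)
      have "poly (R i) (of_nat n) = poly (R i) 0" for n
      proof (induction n)
        case (Suc n)
        then show ?case using shift[of "of_nat n"] by (simp add: add.commute)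
      qed simp
      then have "range of_nat \<subseteq> {z. poly (R i - [:poly (R i) 0:]) z = 0}" by auto
      moreover have "R i - [:poly (R i) 0:] \<noteq> 0"
      proof
        assume "R i - [:poly (R i) 0:] = 0"
        then have "R i = [:poly (R i) 0:]" by simp
        then show False using d by (metis degree_pCons_0)
      qed
      ultimately show False
        using poly_roots_finite finite_subset infinite_UNIV_nat finite_imageD inj_of_nat by blast
    qed
    then obtain c where c: "R i = [:c:]" by (rule degree_eq_zeroE)
    have "(\<Sum>j\<in>I. poly (R j) (of_nat 1) * E j ^ 1) = 0" using Suc.prems(2)[of 1] by simp
    also have "(\<Sum>j\<in>I. poly (R j) (of_nat 1) * E j ^ 1) = (\<Sum>j\<in>I. if j = i then c * E i else 0)"
      using R0 c by (intro sum.cong) auto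
    also have "\<dots> = c * E i" using I Suc.prems(3) by simp
    finally show False using c Ri nz[OF Suc.prems(3)] by simp
  qed
qed

text \<open>The hypothesis says that the functional with weights \<open>c i\<close> at the nodes
  \<open>0, ..., L\<close> kills all polynomials of degree at most \<open>L\<close>. It is tested on
  the one that vanishes at every node except \<open>j\<close>.\<close>

lemma power_sums_eq_0_imp_eq_0:
  fixes c :: "nat \<Rightarrow> 'a :: field_char_0"
  assumes "\<And>m. m \<le> L \<Longrightarrow> (\<Sum>i\<le>L. c i * of_nat i ^ m) = 0" "j \<le> L"
  shows "c j = 0"
proof -
  define P :: "'a poly" where "P = (\<Prod>i\<in>{..L} - {j}. [:- of_nat i, 1:])"
  have "degree P \<le> (\<Sum>i\<in>{..L} - {j}. degree [:- of_nat i :: 'a, 1:])"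
    unfolding P_def by (rule order.trans[OF degree_prod_sum_le]) auto
  also have "\<dots> \<le> L" using assms(2) by simp
  finally have deg: "degree P \<le> L" .
  have "(\<Sum>i\<le>L. c i * poly P (of_nat i)) = (\<Sum>i\<le>L. \<Sum>k\<le>degree P. coeff P k * (c i * of_nat i ^ k))"
    by (simp add: poly_altdef sum_distrib_left mult_ac)
  also have "\<dots> = (\<Sum>k\<le>degree P. coeff P k * (\<Sum>i\<le>L. c i * of_nat i ^ k))"
    by (subst sum.swap) (simp add: sum_distrib_left)
  also have "\<dots> = 0" using assms(1) deg by (intro sum.neutral) auto
  also have "(\<Sum>i\<le>L. c i * poly P (of_nat i)) = (\<Sum>i\<le>L. if i = j then c j * poly P (of_nat j) else 0)"
    by (intro sum.cong) (auto simp: P_def poly_prod)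
  finally have "c j * poly P (of_nat j) = 0" using assms(2) by simp
  moreover have "poly P (of_nat j) \<noteq> 0" by (auto simp: P_def poly_prod)
  ultimately show ?thesis by simp
qed

section \<open>Division of entire functions by their zeros, and a Schwarz lemma\<close>

lemma entire_divide_power:
  assumes g: "g holomorphic_on UNIV" and z: "\<And>t. t < \<tau> \<Longrightarrow> (deriv ^^ t) g a = 0"
  obtains H where "H holomorphic_on UNIV" "\<And>z. g z = (z - a) ^ \<tau> * H z"
proof -
  define c where "c n = (deriv ^^ (n + \<tau>)) g a / fact (n + \<tau>)" for n
  have g_sums: "(\<lambda>n. c n * (w - a) ^ (n + \<tau>)) sums g w" for w
  proof -
    have "w \<in> ball a (dist a w + 1)" by simp
    then have "(\<lambda>n. (deriv ^^ n) g a / fact n * (w - a) ^ n) sums g w"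
      by (intro holomorphic_power_series[where r = "dist a w + 1"] holomorphic_on_subset[OF g]) auto
    then show ?thesis using z by (subst (asm) sums_zero_iff_shift[of \<tau>, symmetric]) (auto simp: c_def)
  qed
  \<comment> \<open>The Taylor series of an entire function converges everywhere; dividing it by a
    power of \<open>w - a\<close> termwise preserves this, so \<open>H\<close> is entire as
    well.\<close>
  define H where "H w = (\<Sum>n. c n * (w - a) ^ n)" for w
  have H_sums: "(\<lambda>n. c n * (w - a) ^ n) sums H w" for w
  proof (cases "w = a")
    case True
    then show ?thesis unfolding H_def
      by (intro summable_sums summable_finite[of "{0}"]) auto
  next
    case False
    have "(\<lambda>n. c n * (w - a) ^ (n + \<tau>) / (w - a) ^ \<tau>) sums (g w / (w - a) ^ \<tau>)"
      by (intro sums_divide g_sums)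
    then show ?thesis using False by (simp add: H_def power_add sums_iff)
  qed
  have "H holomorphic_on ball a r" for r by (rule power_series_holomorphic) (rule H_sums)
  then have "H holomorphic_on UNIV"
    by (metis holomorphic_on_def holomorphic_on_imp_differentiable_at
        field_differentiable_at_within linordered_field_no_ub mem_ball open_ball)
  moreover have "g z = (z - a) ^ \<tau> * H z" for z
  proof (rule sums_unique2[OF g_sums[of z]])
    show "(\<lambda>n. c n * (z - a) ^ (n + \<tau>)) sums ((z - a) ^ \<tau> * H z)"
      using sums_mult[OF H_sums[of z], of "(z - a) ^ \<tau>"] by (simp add: power_add mult_ac)
  qed
  ultimately show thesis by (rule that)
qed

text \<open>The factor \<open>z - a\<close> behaves like a prime that does not divide
  \<open>u\<close>, so it must divide \<open>G\<close>. It is split off once per induction step: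
  away from \<open>a\<close> the common power cancels, and continuity then forces
  \<open>K a = 0\<close>.\<close>

lemma entire_cancel_power:
  assumes "u holomorphic_on UNIV" "G holomorphic_on UNIV" "H holomorphic_on UNIV"
    and "u a \<noteq> 0" "\<And>z. u z * G z = (z - a) ^ \<tau> * H z"
  shows "\<exists>K. K holomorphic_on UNIV \<and> (\<forall>z. G z = (z - a) ^ \<tau> * K z)"
  using assms
proof (induction \<tau> arbitrary: H)
  case 0
  then show ?case by (intro exI[of _ G]) simp
next
  case (Suc \<tau>)
  have "(\<lambda>z. (z - a) * H z) holomorphic_on UNIV" by (intro holomorphic_intros Suc.prems)
  moreover have "u z * G z = (z - a) ^ \<tau> * ((z - a) * H z)" for z using Suc.prems(5)[of z] by (simp add: mult_ac)
  ultimately obtain K where K: "K holomorphic_on UNIV" "\<And>z. G z = (z - a) ^ \<tau> * K z"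
    using Suc.IH[OF Suc.prems(1,2) _ Suc.prems(4), of "\<lambda>z. (z - a) * H z"] by blast
  have eq: "u z * K z - (z - a) * H z = 0" if "z \<noteq> a" for z
    using Suc.prems(5)[of z] K(2)[of z] that by simp
  have "continuous_on UNIV (\<lambda>z. u z * K z - (z - a) * H z)"
    by (intro continuous_intros holomorphic_on_imp_continuous_on K Suc.prems)
  then have "isCont (\<lambda>z. u z * K z - (z - a) * H z) a" by (simp add: continuous_on_eq_continuous_at)
  then have "((\<lambda>z. u z * K z - (z - a) * H z) \<longlongrightarrow> u a * K a) (at a)" by (simp add: isCont_def)
  moreover have "((\<lambda>z. u z * K z - (z - a) * H z) \<longlongrightarrow> 0) (at a)"
    using eq by (intro tendsto_eventually) (auto simp: eventually_at_filter)
  ultimately have "u a * K a = 0" by (rule tendsto_unique[OF at_neq_bot])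
  then have "K a = 0" using Suc.prems(4) by simp
  then obtain K' where "K' holomorphic_on UNIV" "\<And>z. K z = (z - a) ^ 1 * K' z"
    using entire_divide_power[OF K(1), of 1 a] by auto
  then show ?case using K(2) by (intro exI[of _ K']) (simp add: mult_ac)
qed

lemma entire_divide_prod:
  assumes "finite Z" and g: "g holomorphic_on UNIV"
    and "\<And>a t. a \<in> Z \<Longrightarrow> t < \<tau> \<Longrightarrow> (deriv ^^ t) g a = 0"
  shows "\<exists>G. G holomorphic_on UNIV \<and> (\<forall>z. g z = (\<Prod>a\<in>Z. (z - a) ^ \<tau>) * G z)"
  using assms(1,3)
proof (induction Z rule: finite_induct)
  case empty
  then show ?case using g by auto
next
  case (insert a Z)
  then obtain G where G: "G holomorphic_on UNIV" "\<And>z. g z = (\<Prod>a\<in>Z. (z - a) ^ \<tau>) * G z" by auto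
  obtain H where H: "H holomorphic_on UNIV" "\<And>z. g z = (z - a) ^ \<tau> * H z"
    using entire_divide_power[OF g, of \<tau> a] insert.prems by auto
  have "\<exists>K. K holomorphic_on UNIV \<and> (\<forall>z. G z = (z - a) ^ \<tau> * K z)"
  proof (rule entire_cancel_power[OF _ G(1) H(1)])
    show "(\<lambda>z. \<Prod>b\<in>Z. (z - b) ^ \<tau>) holomorphic_on UNIV" by (intro holomorphic_intros)
    show "(\<Prod>b\<in>Z. (a - b) ^ \<tau>) \<noteq> 0" using insert.hyps by auto
  qed (use G(2) H(2) in metis)
  then show ?case using G(2) insert.hyps by (auto simp: mult_ac)
qed

text \<open>A Schwarz lemma. Every zero \<open>a\<close> satisfies
  \<open>norm (v - a) \<ge> 4 * r\<close> on the circle of radius \<open>5 * r\<close> and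
  \<open>norm (w - a) \<le> 2 * r\<close> on the small disc, so each of the
  \<open>S * \<tau>\<close> zeros gains a factor 2.\<close>

lemma entire_small_if_many_zeros:
  assumes g: "g holomorphic_on UNIV"
    and z: "\<And>l t. 1 \<le> l \<Longrightarrow> l \<le> S \<Longrightarrow> t < \<tau> \<Longrightarrow> (deriv ^^ t) g (of_nat l) = 0"
    and r: "real S \<le> r" "0 < r" and B: "\<And>z. norm z \<le> 5 * r \<Longrightarrow> norm (g z) \<le> B"
    and w: "norm w \<le> r"
  shows "norm (g w) * 2 ^ (S * \<tau>) \<le> B"
proof -
  define Z where "Z = (of_nat :: nat \<Rightarrow> complex) ` {1..S}"
  have cZ: "card Z = S" unfolding Z_def by (subst card_image) (auto simp: inj_on_def)
  obtain G where G: "G holomorphic_on UNIV" "\<And>z. g z = (\<Prod>a\<in>Z. (z - a) ^ \<tau>) * G z"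
  proof -
    have "(deriv ^^ t) g a = 0" if "a \<in> Z" "t < \<tau>" for a t using that z by (auto simp: Z_def)
    then show ?thesis using entire_divide_prod[of Z g \<tau>] g that by (auto simp: Z_def)
  qed
  have nZ: "norm a \<le> r" if "a \<in> Z" for a using that r by (auto simp: Z_def)
  have Gb: "norm (G w) \<le> B / (4 * r) ^ (S * \<tau>)"
  proof (rule maximum_modulus_frontier[of G "ball 0 (5 * r)"])
    show "G holomorphic_on interior (ball 0 (5 * r))" using G(1) by (rule holomorphic_on_subset) auto
    show "continuous_on (closure (ball 0 (5 * r))) G"
      using holomorphic_on_imp_continuous_on[OF G(1)] by (rule continuous_on_subset) auto
    show "w \<in> ball 0 (5 * r)" using w r by simp
    fix v :: complex assume "v \<in> frontier (ball 0 (5 * r))"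
    then have v: "norm v = 5 * r" using r by simp
    have "(4 * r) ^ (S * \<tau>) = (\<Prod>a\<in>Z. (4 * r) ^ \<tau>)" by (simp add: cZ power_mult mult.commute[of S])
    also have "\<dots> \<le> (\<Prod>a\<in>Z. norm (v - a) ^ \<tau>)"
    proof (intro prod_mono conjI power_mono)
      fix a assume "a \<in> Z"
      then show "4 * r \<le> norm (v - a)" using nZ[of a] v norm_triangle_ineq2[of v a] by linarith
    qed (use r in auto)
    also have "\<dots> = norm (\<Prod>a\<in>Z. (v - a) ^ \<tau>)" by (simp add: norm_power flip: prod_norm)
    finally have "(4 * r) ^ (S * \<tau>) * norm (G v) \<le> norm (\<Prod>a\<in>Z. (v - a) ^ \<tau>) * norm (G v)"
      by (rule mult_right_mono) simp
    also have "\<dots> = norm (g v)" by (simp add: G(2) norm_mult)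
    also have "\<dots> \<le> B" using v by (intro B) simp
    finally show "norm (G v) \<le> B / (4 * r) ^ (S * \<tau>)" using r by (simp add: field_simps)
  qed (use r in auto)
  have "norm (\<Prod>a\<in>Z. (w - a) ^ \<tau>) = (\<Prod>a\<in>Z. norm (w - a) ^ \<tau>)" by (simp add: norm_power flip: prod_norm)
  also have "\<dots> \<le> (\<Prod>a\<in>Z. (2 * r) ^ \<tau>)"
  proof (intro prod_mono conjI power_mono)
    fix a assume "a \<in> Z"
    then show "norm (w - a) \<le> 2 * r" using nZ[of a] w norm_triangle_ineq4[of w a] by linarith
  qed (use r in auto)
  also have "\<dots> = (2 * r) ^ (S * \<tau>)" by (simp add: cZ power_mult mult.commute[of S])
  finally have "norm (g w) \<le> (2 * r) ^ (S * \<tau>) * (B / (4 * r) ^ (S * \<tau>))"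
    unfolding G(2) norm_mult using Gb r by (intro mult_mono) auto
  then have "norm (g w) * 2 ^ (S * \<tau>) \<le> (2 * r) ^ (S * \<tau>) * (B / (4 * r) ^ (S * \<tau>)) * 2 ^ (S * \<tau>)"
    by (rule mult_right_mono) simp
  also have "\<dots> = (2 * r * 2) ^ (S * \<tau>) * (B / (4 * r) ^ (S * \<tau>))"
    by (simp only: power_mult_distrib mult_ac)
  also have "\<dots> = B" using r by (simp add: mult_ac)
  finally show ?thesis .
qed

subsection \<open>The auxiliary function\<close>

text \<open>The bound by the maximal row sum for an eigenvalue: apply the matrix row of the element
  of \<open>V\<close> with largest norm. That norm is positive because
  \<open>1 \<in> V\<close>.\<close>

lemma zrep_norm_le:
  assumes V: "finite V" "1 \<in> V" and x: "zrep V b x" shows "norm x \<le> real b"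
proof -
  define r where "r = Max (norm ` V)"
  have "r \<in> norm ` V" unfolding r_def using V by (intro Max_in) auto
  then obtain v where v: "v \<in> V" "norm v = r" by auto
  have le: "norm w \<le> r" if "w \<in> V" for w unfolding r_def using V that by (intro Max_ge) auto
  have "r > 0" using le[OF V(2)] by simp
  obtain M where M: "x * v = (\<Sum>w\<in>V. of_int (M v w) * w)" "(\<Sum>w\<in>V. \<bar>M v w\<bar>) \<le> int b"
    using x v(1) unfolding zrep_def by blast
  have "norm x * r = norm (\<Sum>w\<in>V. of_int (M v w) * w)" using M(1) v(2) by (metis norm_mult)
  also have "\<dots> \<le> (\<Sum>w\<in>V. \<bar>of_int (M v w)\<bar> * r)"
    by (intro sum_norm_le) (simp add: norm_mult le mult_left_mono)
  also have "\<dots> = of_int (\<Sum>w\<in>V. \<bar>M v w\<bar>) * r" by (simp add: sum_distrib_right)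
  also have "\<dots> \<le> real b * r"
    using M(2) \<open>r > 0\<close> by (intro mult_right_mono) (metis of_int_le_iff of_int_of_nat_eq, simp)
  finally show ?thesis using \<open>r > 0\<close> by simp
qed

lemma higher_deriv_lincomb:
  assumes "finite I" "\<And>i. i \<in> I \<Longrightarrow> f i holomorphic_on UNIV"
  shows "(deriv ^^ t) (\<lambda>z. \<Sum>i\<in>I. c i * f i z) w = (\<Sum>i\<in>I. c i * (deriv ^^ t) (f i) w)"
  using assms
proof (induction I rule: finite_induct)
  case empty
  then show ?case by (simp add: higher_deriv_const)
next
  case (insert i I)
  have "(deriv ^^ t) (\<lambda>z. c i * f i z + (\<Sum>i\<in>I. c i * f i z)) w
      = (deriv ^^ t) (\<lambda>z. c i * f i z) w + (deriv ^^ t) (\<lambda>z. \<Sum>i\<in>I. c i * f i z) w"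
    using insert.prems by (intro higher_deriv_add[of _ UNIV]) (auto intro!: holomorphic_intros)
  then show ?case using insert by (simp add: higher_deriv_cmult[of _ UNIV])
qed

text \<open>\<open>diff_eval k s Q\<close> is the value at \<open>s\<close> of the differential operator \<open>Q(d/ds)\<close> applied to
  \<open>s\<^sup>k\<close>.\<close>

definition diff_eval :: "nat \<Rightarrow> complex \<Rightarrow> complex poly \<Rightarrow> complex" where
  "diff_eval k s Q = (\<Sum>j\<le>k. coeff Q j * of_nat ((k choose j) * fact j) * s ^ (k - j))"

lemma coeff_linear_mult: "coeff ([:a, b:] * Q) j = a * coeff Q j + b * coeff (pCons 0 Q) j"
  by (cases j) simp_all

lemma diff_eval_mult_linear:
  "diff_eval k s ([:a, b:] * Q) = a * diff_eval k s Q + b * diff_eval k s (pCons 0 Q)"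
  by (simp only: diff_eval_def coeff_linear_mult sum_distrib_left distrib_right sum.distrib mult.assoc)

text \<open>Multiplying \<open>Q\<close> by its variable means one more d/ds. On coefficients this
  is the recursion \<open>fall\<close> for falling factorials.\<close>

lemma has_field_derivative_diff_eval:
  "((\<lambda>s. diff_eval k s Q) has_field_derivative diff_eval k s (pCons 0 Q)) (at s)"
proof -
  have fall: "(k - j) * ((k choose j) * fact j) = (k choose Suc j) * fact (Suc j)" for j
    unfolding fact_Suc mult.assoc[symmetric] binomial_absorb_comp
    by (subst binomial_absorption[symmetric]) simp
  have "((\<lambda>s. diff_eval k s Q) has_field_derivative
      (\<Sum>j\<le>k. coeff Q j * of_nat ((k choose j) * fact j) * (of_nat (k - j) * s ^ (k - j - 1)))) (at s)"
    unfolding diff_eval_def by (auto intro!: derivative_eq_intros sum.cong)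
  also have "(\<Sum>j\<le>k. coeff Q j * of_nat ((k choose j) * fact j) * (of_nat (k - j) * s ^ (k - j - 1)))
      = (\<Sum>j\<le>k. coeff Q j * of_nat ((k choose Suc j) * fact (Suc j)) * s ^ (k - Suc j))"
    unfolding fall[symmetric] by (intro sum.cong) (simp_all add: mult_ac)
  also have "\<dots> = (\<Sum>j<k. coeff Q j * of_nat ((k choose Suc j) * fact (Suc j)) * s ^ (k - Suc j))"
    by (intro sum.mono_neutral_right) (auto simp: binomial_eq_0 simp del: fact_Suc binomial_Suc_Suc)
  also have "\<dots> = (\<Sum>j\<le>k. coeff (pCons 0 Q) j * of_nat ((k choose j) * fact j) * s ^ (k - j))"
  proof (cases k)
    case (Suc i)
    show ?thesis unfolding Suc lessThan_Suc_atMost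
      by (subst sum.atMost_Suc_shift) (simp del: fact_Suc binomial_Suc_Suc)
  qed simp
  finally show ?thesis by (simp add: diff_eval_def)
qed

lemma zrep_diff_eval:
  assumes V: "finite V" and s: "zrep V \<sigma> s" "1 \<le> \<sigma>" and Q: "\<And>j. zrep V C (coeff Q j)" and k: "k \<le> L"
  shows "zrep V ((L + 1) * (C * (L + 1) ^ L * \<sigma> ^ L)) (diff_eval k s Q)"
proof -
  have "zrep V (\<Sum>j\<le>k. C * ((k choose j) * fact j) * \<sigma> ^ (k - j)) (diff_eval k s Q)"
    unfolding diff_eval_def by (intro zrep_sum zrep_mult zrep_of_nat zrep_power V s Q)
  moreover have "(\<Sum>j\<le>k. C * ((k choose j) * fact j) * \<sigma> ^ (k - j)) \<le> (\<Sum>j\<le>k. C * (L + 1) ^ L * \<sigma> ^ L)"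
  proof (intro sum_mono mult_mono)
    fix j assume j: "j \<in> {..k}"
    have "(k choose j) * fact j \<le> k ^ j" by (rule binomial_fact_pow)
    also have "\<dots> \<le> (L + 1) ^ j" using k by (intro power_mono) auto
    also have "\<dots> \<le> (L + 1) ^ L" using j k by (intro power_increasing) auto
    finally show "(k choose j) * fact j \<le> (L + 1) ^ L" .
    show "\<sigma> ^ (k - j) \<le> \<sigma> ^ L" using s(2) k by (intro power_increasing) auto
  qed auto
  moreover have "(\<Sum>j\<le>k. C * (L + 1) ^ L * \<sigma> ^ L) \<le> (L + 1) * (C * (L + 1) ^ L * \<sigma> ^ L)"
    using k by simp
  ultimately show ?thesis by (meson zrep_mono order_trans)
qed

lemma norm_diff_eval_le:
  assumes s: "norm s \<le> \<sigma>" "1 \<le> \<sigma>" and Q: "\<And>j. norm (coeff Q j) \<le> C" and k: "k \<le> L"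
  shows "norm (diff_eval k s Q) \<le> real (L + 1) * (C * real (L + 1) ^ L * \<sigma> ^ L)"
proof -
  have C: "C \<ge> 0" using Q[of 0] norm_ge_zero order_trans by blast
  have "norm (diff_eval k s Q) \<le> (\<Sum>j\<le>k. C * real (L + 1) ^ L * \<sigma> ^ L)"
    unfolding diff_eval_def
  proof (intro sum_norm_le)
    fix j assume j: "j \<in> {..k}"
    have "(k choose j) * fact j \<le> k ^ j" by (rule binomial_fact_pow)
    also have "\<dots> \<le> (L + 1) ^ j" using k by (intro power_mono) auto
    also have "\<dots> \<le> (L + 1) ^ L" using j k by (intro power_increasing) auto
    finally have 1: "real ((k choose j) * fact j) \<le> real (L + 1) ^ L" by (metis of_nat_le_iff of_nat_power)
    have "norm s ^ (k - j) \<le> \<sigma> ^ (k - j)" using s by (intro power_mono) auto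
    also have "\<dots> \<le> \<sigma> ^ L" using s(2) k by (intro power_increasing) auto
    finally have 2: "norm s ^ (k - j) \<le> \<sigma> ^ L" .
    have "norm (coeff Q j * of_nat ((k choose j) * fact j) * s ^ (k - j))
        = norm (coeff Q j) * real ((k choose j) * fact j) * norm s ^ (k - j)"
      by (simp only: norm_mult norm_power norm_of_nat)
    also have "\<dots> \<le> C * real (L + 1) ^ L * \<sigma> ^ L"
      using 1 2 Q[of j] C s by (intro mult_mono) auto
    finally show "norm (coeff Q j * of_nat ((k choose j) * fact j) * s ^ (k - j)) \<le> C * real (L + 1) ^ L * \<sigma> ^ L" .
  qed
  also have "\<dots> = real (k + 1) * (C * real (L + 1) ^ L * \<sigma> ^ L)" by simp
  also have "\<dots> \<le> real (L + 1) * (C * real (L + 1) ^ L * \<sigma> ^ L)"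
    using k C s by (intro mult_right_mono) auto
  finally show ?thesis .
qed

text \<open>One constant \<open>A\<close> serves as height of all algebraic data and as bound for
  the \<open>x\<close>. The logarithms \<open>x\<close> are not assumed algebraic and are controlled
  only in norm; algebraicity of the linear form, the assumption to be refuted when the form is
  nonzero, is \<open>zrep_form\<close>.\<close>

locale log_linear_form =
  fixes X V :: "complex set" and \<beta> :: "complex \<Rightarrow> complex" and A :: nat
  assumes finite_X: "finite X" and finite_V: "finite V" and one_in_V: "1 \<in> V" and A_pos: "1 \<le> A"
    and zrep_\<beta>: "\<And>x. x \<in> X \<Longrightarrow> zrep V A (\<beta> x)"
    and zrep_exp: "\<And>x. x \<in> X \<Longrightarrow> zrep V A (exp x)"
    and norm_X: "\<And>x. x \<in> X \<Longrightarrow> norm x \<le> real A"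
    and zrep_form: "zrep V A (\<Sum>x\<in>X. \<beta> x * x)"
begin

definition "form = (\<Sum>x\<in>X. \<beta> x * x)"

text \<open>With s the linear form, the partial derivative in direction \<open>x\<close> of f(s)
  times the exponential with exponents \<open>\<mu>\<close> is the same exponential times
  (\<open>\<mu> x\<close> + \<open>\<beta> x\<close> d/ds) f(s). So \<open>oper m \<mu>\<close> is
  the symbol, as a polynomial in d/ds, of the mixed derivative of order \<open>m\<close>.\<close>

definition oper :: "(complex \<Rightarrow> nat) \<Rightarrow> (complex \<Rightarrow> nat) \<Rightarrow> complex poly" where
  "oper m \<mu> = (\<Prod>x\<in>X. [:of_nat (\<mu> x), \<beta> x:] ^ m x)"

text \<open>The derivative of \<open>(\<Sum>\<beta> x * z x) ^ k * exp (\<Sum>\<mu> x * z x)\<close> of multi-order \<open>m\<close> in the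
  variables \<open>z x\<close>, evaluated at the point \<open>z x = z * x\<close> of the complex line through \<open>X\<close>.\<close>

definition aux_term :: "(complex \<Rightarrow> nat) \<Rightarrow> nat \<times> (complex \<Rightarrow> nat) \<Rightarrow> complex \<Rightarrow> complex" where
  "aux_term m u z = diff_eval (fst u) (form * z) (oper m (snd u)) * exp (z * (\<Sum>x\<in>X. of_nat (snd u x) * x))"

definition index :: "nat \<Rightarrow> (nat \<times> (complex \<Rightarrow> nat)) set" where
  "index L = {..L} \<times> PiE X (\<lambda>_. {..L})"

definition aux :: "nat \<Rightarrow> (nat \<times> (complex \<Rightarrow> nat) \<Rightarrow> int) \<Rightarrow> (complex \<Rightarrow> nat) \<Rightarrow> complex \<Rightarrow> complex" where
  "aux L p m z = (\<Sum>u\<in>index L. of_int (p u) * aux_term m u z)"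

lemma finite_index: "finite (index L)"
  unfolding index_def using finite_X by (auto intro: finite_PiE)

lemma card_index: "card (index L) = (L + 1) ^ (card X + 1)"
  unfolding index_def using finite_X by (simp add: card_cartesian_product card_PiE)

lemma oper_Suc:
  assumes "x \<in> X" shows "oper (m(x := Suc (m x))) \<mu> = [:of_nat (\<mu> x), \<beta> x:] * oper m \<mu>"
proof -
  have "(\<Prod>y\<in>X - {x}. [:of_nat (\<mu> y), \<beta> y:] ^ (m(x := Suc (m x))) y) = (\<Prod>y\<in>X - {x}. [:of_nat (\<mu> y), \<beta> y:] ^ m y)"
    by (intro prod.cong) auto
  then show ?thesis using assms finite_X
    by (simp add: oper_def prod.remove[of X x] mult.assoc del: mult_pCons_left)
qed

text \<open>The chain rule on the line \<open>z x = z * x\<close>: the derivative along it is the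
  sum of the partial derivatives weighted by the direction \<open>x\<close>.\<close>

lemma has_field_derivative_aux_term:
  "(aux_term m u has_field_derivative (\<Sum>x\<in>X. x * aux_term (m(x := Suc (m x))) u z)) (at z)"
proof -
  obtain k \<mu> where u: "u = (k, \<mu>)" by force
  define w where "w = (\<Sum>x\<in>X. of_nat (\<mu> x) * x)"
  define Q where "Q = oper m \<mu>"
  have "(aux_term m u has_field_derivative
     diff_eval k (form * z) (pCons 0 Q) * form * exp (z * w) + w * exp (z * w) * diff_eval k (form * z) Q) (at z)"
    unfolding aux_term_def u w_def[symmetric] Q_def[symmetric] fst_conv snd_conv
    by (rule derivative_eq_intros DERIV_chain'[OF _ has_field_derivative_diff_eval] refl | simp)+
  also have "diff_eval k (form * z) (pCons 0 Q) * form * exp (z * w) + w * exp (z * w) * diff_eval k (form * z) Q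
     = (\<Sum>x\<in>X. x * (of_nat (\<mu> x) * diff_eval k (form * z) Q + \<beta> x * diff_eval k (form * z) (pCons 0 Q)) * exp (z * w))"
    by (simp add: w_def[symmetric] form_def algebra_simps sum.distrib sum_distrib_left sum_distrib_right)
      (simp add: w_def sum_distrib_left sum_distrib_right mult_ac)
  also have "\<dots> = (\<Sum>x\<in>X. x * aux_term (m(x := Suc (m x))) u z)"
    by (intro sum.cong) (simp_all add: aux_term_def u oper_Suc diff_eval_mult_linear Q_def w_def del: mult_pCons_left)
  finally show ?thesis .
qed

lemma has_field_derivative_aux:
  "(aux L p m has_field_derivative (\<Sum>x\<in>X. x * aux L p (m(x := Suc (m x))) z)) (at z)"
proof -
  have "(aux L p m has_field_derivative
      (\<Sum>u\<in>index L. of_int (p u) * (\<Sum>x\<in>X. x * aux_term (m(x := Suc (m x))) u z))) (at z)"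
    unfolding aux_def by (intro DERIV_sum DERIV_cmult has_field_derivative_aux_term)
  also have "(\<Sum>u\<in>index L. of_int (p u) * (\<Sum>x\<in>X. x * aux_term (m(x := Suc (m x))) u z))
      = (\<Sum>x\<in>X. x * aux L p (m(x := Suc (m x))) z)"
    unfolding aux_def sum_distrib_left by (subst sum.swap) (simp add: mult_ac)
  finally show ?thesis .
qed

lemma holomorphic_aux: "aux L p m holomorphic_on UNIV"
  unfolding holomorphic_on_open[OF open_UNIV] using has_field_derivative_aux by blast

lemma sum_fun_upd_Suc: "x \<in> X \<Longrightarrow> sum (m(x := Suc (m x))) X = Suc (sum m X)"
proof -
  assume x: "x \<in> X"
  have "(\<Sum>y\<in>X - {x}. (m(x := Suc (m x))) y) = (\<Sum>y\<in>X - {x}. m y)" by (intro sum.cong) auto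
  then show ?thesis using x finite_X by (simp add: sum.remove[of X x])
qed

text \<open>Each derivative along the line raises the total order of the mixed derivatives by one,
  so vanishing of the latter up to order \<open>sum m X + t\<close> suffices.\<close>

lemma higher_deriv_aux_eq_0:
  assumes "\<And>m'. sum m' X \<le> sum m X + t \<Longrightarrow> aux L p m' w = 0"
  shows "(deriv ^^ t) (aux L p m) w = 0"
  using assms
proof (induction t arbitrary: m)
  case 0
  then show ?case by simp
next
  case (Suc t)
  have "(deriv ^^ Suc t) (aux L p m) w = (deriv ^^ t) (\<lambda>z. \<Sum>x\<in>X. x * aux L p (m(x := Suc (m x))) z) w"
  proof -
    have "deriv (aux L p m) = (\<lambda>z. \<Sum>x\<in>X. x * aux L p (m(x := Suc (m x))) z)"
      using has_field_derivative_aux DERIV_imp_deriv by blast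
    then show ?thesis by (simp only: funpow_Suc_right o_apply)
  qed
  also have "\<dots> = (\<Sum>x\<in>X. x * (deriv ^^ t) (aux L p (m(x := Suc (m x)))) w)"
    by (rule higher_deriv_lincomb) (simp_all add: finite_X holomorphic_aux)
  also have "\<dots> = 0"
  proof (intro sum.neutral ballI)
    fix x assume "x \<in> X"
    have "(deriv ^^ t) (aux L p (m(x := Suc (m x)))) w = 0"
    proof (rule Suc.IH)
      fix m' assume "sum m' X \<le> sum (m(x := Suc (m x))) X + t"
      then show "aux L p m' w = 0"
        unfolding sum_fun_upd_Suc[OF \<open>x \<in> X\<close>] by (intro Suc.prems) simp
    qed
    then show "x * (deriv ^^ t) (aux L p (m(x := Suc (m x)))) w = 0" by simp
  qed
  finally show ?case .
qed

text \<open>Each of the \<open>sum m X\<close> linear factors multiplies the height by at most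
  \<open>L + A\<close>: its constant term is a natural number at most \<open>L\<close>, its other
  coefficient some \<open>\<beta> x\<close>.\<close>

lemma zrep_coeff_oper:
  assumes "\<And>x. x \<in> X \<Longrightarrow> \<mu> x \<le> L"
  shows "zrep V ((L + A) ^ sum m X) (coeff (oper m \<mu>) j)"
proof -
  have step: "zrep V (C * (L + A)) (coeff ([:of_nat (\<mu> x), \<beta> x:] * Q) j)"
    if "x \<in> X" "\<And>j. zrep V C (coeff Q j)" for x C Q j
  proof -
    have "zrep V (\<mu> x * C + A * C) (of_nat (\<mu> x) * coeff Q j + \<beta> x * coeff (pCons 0 Q) j)"
    proof (intro zrep_add zrep_mult zrep_of_nat finite_V zrep_\<beta> that)
      show "zrep V C (coeff (pCons 0 Q) j)"
        by (cases j) (use that zrep_mono[OF zrep_of_nat[OF finite_V, of 0]] in auto)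
    qed
    moreover have "\<mu> x * C + A * C \<le> C * (L + A)"
      using assms[OF that(1)] by (simp add: algebra_simps)
    ultimately show ?thesis unfolding coeff_linear_mult by (rule zrep_mono)
  qed
  have pow: "zrep V (C * (L + A) ^ e) (coeff ([:of_nat (\<mu> x), \<beta> x:] ^ e * Q) j)"
    if "x \<in> X" "\<And>j. zrep V C (coeff Q j)" for x e C Q j
  proof (induction e arbitrary: j)
    case (Suc e)
    show ?case using step[OF that(1) Suc.IH, of j] by (simp only: power_Suc mult_ac)
  qed (use that in simp)
  have "zrep V ((L + A) ^ sum m Y) (coeff (\<Prod>x\<in>Y. [:of_nat (\<mu> x), \<beta> x:] ^ m x) j)" if "finite Y" "Y \<subseteq> X" for Y
    using that
  proof (induction Y arbitrary: j rule: finite_induct)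
    case empty
    then show ?case using zrep_1[OF finite_V] zrep_mono[OF zrep_of_nat[OF finite_V, of 0], of 1] by (cases j) auto
  next
    case (insert x Y)
    then show ?case using pow[of x "(L + A) ^ sum m Y" "\<Prod>x\<in>Y. [:of_nat (\<mu> x), \<beta> x:] ^ m x" "m x" j]
      by (simp add: power_add mult_ac)
  qed
  then show ?thesis unfolding oper_def using finite_X by auto
qed

text \<open>This is why integer points are used: there the polynomial part is evaluated at the
  algebraic number \<open>form * l\<close>, and the exponential becomes a monomial in the
  \<open>exp x\<close>.\<close>

lemma zrep_aux_term:
  assumes u: "u \<in> index L" and l: "1 \<le> l"
  shows "zrep V ((L + 1) * ((L + A) ^ sum m X * (L + 1) ^ L * (A * l) ^ L) * A ^ (card X * L * l))
    (aux_term m u (of_nat l))"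
proof -
  obtain k \<mu> where uk: "u = (k, \<mu>)" "k \<le> L" "\<And>x. x \<in> X \<Longrightarrow> \<mu> x \<le> L" using u by (auto simp: index_def)
  have exp_eq: "exp (of_nat l * (\<Sum>x\<in>X. of_nat (\<mu> x) * x)) = (\<Prod>x\<in>X. exp x ^ (l * \<mu> x))"
    using finite_X by (simp add: sum_distrib_left exp_sum exp_of_nat_mult[symmetric] mult.assoc)
  moreover have "zrep V (\<Prod>x\<in>X. A ^ (l * \<mu> x)) (\<Prod>x\<in>X. exp x ^ (l * \<mu> x))"
    by (intro zrep_prod zrep_power finite_V zrep_exp)
  moreover have "(\<Prod>x\<in>X. A ^ (l * \<mu> x)) \<le> A ^ (card X * L * l)"
  proof -
    have "(\<Sum>x\<in>X. l * \<mu> x) \<le> card X * L * l"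
      using sum_bounded_above[of X "\<lambda>x. l * \<mu> x" "l * L"] uk(3) by (simp add: mult_ac)
    then show ?thesis using A_pos by (simp flip: power_sum) (intro power_increasing; simp)
  qed
  ultimately have "zrep V (A ^ (card X * L * l)) (exp (of_nat l * (\<Sum>x\<in>X. of_nat (\<mu> x) * x)))"
    unfolding exp_eq by - (rule zrep_mono)
  moreover have "zrep V ((L + 1) * ((L + A) ^ sum m X * (L + 1) ^ L * (A * l) ^ L))
     (diff_eval k (form * of_nat l) (oper m \<mu>))"
  proof (rule zrep_diff_eval[OF finite_V _ _ _ uk(2)])
    show "zrep V (A * l) (form * of_nat l)"
      unfolding form_def by (intro zrep_mult zrep_form zrep_of_nat finite_V)
    show "1 \<le> A * l" using A_pos l by simp
    show "zrep V ((L + A) ^ sum m X) (coeff (oper m \<mu>) j)" for j by (rule zrep_coeff_oper) (rule uk(3))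
  qed
  ultimately show ?thesis unfolding aux_term_def uk(1) fst_conv snd_conv by (intro zrep_mult)
qed

lemma norm_aux_term:
  assumes u: "u \<in> index L" and z: "norm z \<le> R" "1 \<le> R"
  shows "norm (aux_term m u z) \<le>
    real (L + 1) * (real ((L + A) ^ sum m X) * real (L + 1) ^ L * (real A * R) ^ L) * exp (R * (card X * L * A))"
proof -
  obtain k \<mu> where uk: "u = (k, \<mu>)" "k \<le> L" "\<And>x. x \<in> X \<Longrightarrow> \<mu> x \<le> L" using u by (auto simp: index_def)
  have form: "norm form \<le> A" using zrep_norm_le[OF finite_V one_in_V zrep_form] by (simp add: form_def)
  have "norm (z * (\<Sum>x\<in>X. of_nat (\<mu> x) * x)) \<le> R * (card X * L * A)"
  proof -
    have "norm (\<Sum>x\<in>X. of_nat (\<mu> x) * x) \<le> (\<Sum>x\<in>X. real L * real A)"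
      using uk(3) norm_X by (intro sum_norm_le) (simp add: norm_mult mult_mono)
    then show ?thesis unfolding norm_mult using z by (intro mult_mono) auto
  qed
  then have "norm (exp (z * (\<Sum>x\<in>X. of_nat (\<mu> x) * x))) \<le> exp (R * (card X * L * A))"
    by (intro order.trans[OF norm_exp]) simp
  moreover have "norm (diff_eval k (form * z) (oper m \<mu>))
      \<le> real (L + 1) * (real ((L + A) ^ sum m X) * real (L + 1) ^ L * (real A * R) ^ L)"
  proof (rule norm_diff_eval_le[OF _ _ _ uk(2)])
    show "norm (form * z) \<le> real A * R" unfolding norm_mult using form z by (intro mult_mono) auto
    show "1 \<le> real A * R" using A_pos z mult_mono[of 1 "real A" 1 R] by simp
    show "norm (coeff (oper m \<mu>) j) \<le> real ((L + A) ^ sum m X)" for j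
      by (rule zrep_norm_le[OF finite_V one_in_V zrep_coeff_oper]) (rule uk)
  qed
  ultimately show ?thesis unfolding aux_term_def uk(1) norm_mult fst_conv snd_conv
    by (intro mult_mono) (use z in auto)
qed

end

subsection \<open>Extrapolation\<close>

context log_linear_form
begin

text \<open>For a large parameter \<open>N\<close> the auxiliary function has degrees at most \<open>L = N ^ deg_exp\<close>; after
  \<open>J\<close> extrapolation steps its derivatives of order at most \<open>(steps + 1 - J) * N ^ ord_exp\<close> vanish at
  \<open>1, \<dots>, N ^ (J + 1)\<close>. The exponents are chosen such that \<open>deg_exp * (n + 1)\<close> exceeds
  \<open>ord_exp * n + 1\<close>, which makes Siegel's lemma applicable, such that
  \<open>L * N ^ (J + 2) = N ^ (ord_exp + J)\<close>, the order of growth, is smaller by a factor \<open>N\<close> than the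
  number of zeros, and such that \<open>N ^ steps\<close> exceeds the number of coefficients in the zero estimate.\<close>

definition "n = card X"
definition "ord_exp = 2 * n + 4"
definition "deg_exp = 2 * n + 2"
definition "steps = (2 * n + 3) * n"
text \<open>These constants are the factors c in bounds of the form \<open>N ^ (c * U)\<close>,
  where \<open>U\<close> is the order of growth: for the height of one term, the coefficients from
  Siegel's lemma (at \<open>J = 0\<close>), the size of one term on the large disc, and height and
  size of the whole function. The last one also includes the loss in the Liouville
  inequality.\<close>

definition "rep_const = 2 * (deg_exp + 1) + (deg_exp + 1) * (steps + 1) + (steps + 4) + n"
definition "coeff_const = rep_const + (deg_exp + 1) * (n + 1) + 1"
definition "growth_const = 2 * (deg_exp + 1) + (deg_exp + 1) * (steps + 1) + (steps + 4) + 5 * n * A"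
definition "total_const = (deg_exp + 1) * (n + 1) + coeff_const + rep_const + growth_const"
definition "final_const = total_const * (2 * card V + 1) + 10 * card V ^ 2"

text \<open>Every factor in the bounds for a term is brought to the form \<open>N ^ (c * U)\<close>
  with c independent of \<open>N\<close> and \<open>J\<close>. The number \<open>y\<close> stands
  for \<open>A\<close> times an integer point or times a radius.\<close>

lemma size_bounds:
  fixes N J s :: nat
  assumes N: "5 \<le> N" "A \<le> N" and J: "J \<le> steps" and s: "s \<le> (steps + 1) * N ^ ord_exp"
  defines "L \<equiv> N ^ deg_exp" and "U \<equiv> N ^ (ord_exp + J)"
  shows "L + 1 \<le> N ^ (deg_exp + 1)" "U \<ge> 1" "L \<le> U"
    "(L + A) ^ s \<le> N ^ ((deg_exp + 1) * (steps + 1) * U)"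
    "(L + 1) ^ L \<le> N ^ ((deg_exp + 1) * U)"
    "y \<le> N ^ (J + 4) \<Longrightarrow> y ^ L \<le> N ^ ((steps + 4) * U)"
    "L * N ^ (J + 2) = U"
proof -
  have N0: "N > 0" using N by simp
  show U: "U \<ge> 1" unfolding U_def using N0 by simp
  have L1: "L \<ge> 1" unfolding L_def using N0 by simp
  show *: "L + 1 \<le> N ^ (deg_exp + 1)"
  proof -
    have "L + 1 \<le> 2 * L" using L1 by simp
    also have "\<dots> \<le> N * L" using N by (intro mult_right_mono) auto
    finally show ?thesis by (simp add: L_def)
  qed
  show LU: "L \<le> U" unfolding L_def U_def using N0 by (intro power_increasing) (auto simp: deg_exp_def ord_exp_def)
  have TU: "N ^ ord_exp \<le> U" unfolding U_def using N0 by (intro power_increasing) auto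
  have "deg_exp + (J + 2) = ord_exp + J" by (simp add: deg_exp_def ord_exp_def)
  then show "L * N ^ (J + 2) = U" by (simp only: L_def U_def flip: power_add)
  have LA: "L + A \<le> N ^ (deg_exp + 1)"
  proof -
    have "N ^ 1 \<le> N ^ deg_exp" using N0 by (intro power_increasing) (auto simp: deg_exp_def)
    then have "A \<le> N ^ deg_exp" using N by simp
    then have "L + A \<le> 2 * L" by (simp add: L_def)
    also have "\<dots> \<le> N * L" using N by (intro mult_right_mono) auto
    finally show ?thesis by (simp add: L_def)
  qed
  have "(L + A) ^ s \<le> (N ^ (deg_exp + 1)) ^ s" using LA by (intro power_mono) auto
  also have "\<dots> = N ^ ((deg_exp + 1) * s)" by (simp only: power_mult)
  also have "\<dots> \<le> N ^ ((deg_exp + 1) * (steps + 1) * U)"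
  proof (intro power_increasing)
    have "(deg_exp + 1) * s \<le> (deg_exp + 1) * ((steps + 1) * U)"
      using s TU by (intro mult_le_mono2) (meson le_trans mult_le_mono2)
    then show "(deg_exp + 1) * s \<le> (deg_exp + 1) * (steps + 1) * U" by (simp only: mult.assoc)
  qed (use N0 in auto)
  finally show "(L + A) ^ s \<le> N ^ ((deg_exp + 1) * (steps + 1) * U)" .
  have "(L + 1) ^ L \<le> (N ^ (deg_exp + 1)) ^ L" using * by (intro power_mono) auto
  also have "\<dots> = N ^ ((deg_exp + 1) * L)" by (simp only: power_mult)
  also have "\<dots> \<le> N ^ ((deg_exp + 1) * U)" using N0 LU by (intro power_increasing mult_le_mono2) auto
  finally show "(L + 1) ^ L \<le> N ^ ((deg_exp + 1) * U)" .
  show "y ^ L \<le> N ^ ((steps + 4) * U)" if y: "y \<le> N ^ (J + 4)"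
  proof -
    have "y ^ L \<le> (N ^ (J + 4)) ^ L" using y by (intro power_mono) auto
    also have "\<dots> = N ^ ((J + 4) * L)" by (simp only: power_mult)
    also have "\<dots> \<le> N ^ ((steps + 4) * U)" using N0 LU J by (intro power_increasing mult_le_mono) auto
    finally show ?thesis .
  qed
qed

lemma zrep_aux_term':
  assumes N: "5 \<le> N" "A \<le> N" and J: "J \<le> steps" and m: "sum m X \<le> (steps + 1) * N ^ ord_exp"
    and l: "1 \<le> l" "l \<le> N ^ (J + 2)" and u: "u \<in> index (N ^ deg_exp)"
  shows "zrep V (N ^ (rep_const * N ^ (ord_exp + J))) (aux_term m u (of_nat l))"
proof (rule zrep_mono[OF zrep_aux_term[OF u l(1)]])
  define L where "L = N ^ deg_exp"
  define U where "U = N ^ (ord_exp + J)"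
  note sb = size_bounds[OF N J m, folded L_def U_def]
  have N0: "N > 0" using N by simp
  have f1: "L + 1 \<le> N ^ ((deg_exp + 1) * U)"
  proof (rule order.trans[OF sb(1)])
    show "N ^ (deg_exp + 1) \<le> N ^ ((deg_exp + 1) * U)"
      using mult_le_mono2[OF sb(2), of "deg_exp + 1"] N0 by (intro power_increasing) auto
  qed
  have "A * l \<le> N * N ^ (J + 2)" using N l by (intro mult_le_mono)
  also have "\<dots> = N ^ (J + 3)" by (simp add: numeral_eq_Suc)
  also have "\<dots> \<le> N ^ (J + 4)" using N0 by (intro power_increasing) auto
  finally have f2: "(A * l) ^ L \<le> N ^ ((steps + 4) * U)" by (rule sb(6))
  have "A ^ (card X * L * l) \<le> N ^ (card X * L * l)" using N by (intro power_mono) auto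
  also have "\<dots> \<le> N ^ (n * U)"
  proof (intro power_increasing)
    have "card X * (L * l) \<le> n * (L * N ^ (J + 2))" using l unfolding n_def by (intro mult_le_mono) auto
    then show "card X * L * l \<le> n * U" by (simp only: sb(7) mult.assoc)
  qed (use N0 in auto)
  finally have f3: "A ^ (card X * L * l) \<le> N ^ (n * U)" .
  have "(L + 1) * ((L + A) ^ sum m X * (L + 1) ^ L * (A * l) ^ L) * A ^ (card X * L * l)
     \<le> N ^ ((deg_exp + 1) * U) * (N ^ ((deg_exp + 1) * (steps + 1) * U) * N ^ ((deg_exp + 1) * U) * N ^ ((steps + 4) * U)) * N ^ (n * U)"
    by (intro mult_le_mono f1 f2 f3 sb(4,5))
  also have "\<dots> = N ^ (rep_const * U)"
    by (simp only: rep_const_def power_add[symmetric]) (rule arg_cong[where f = "\<lambda>e. N ^ e"], simp add: algebra_simps)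
  finally show "(N ^ deg_exp + 1) * ((N ^ deg_exp + A) ^ sum m X * (N ^ deg_exp + 1) ^ (N ^ deg_exp) * (A * l) ^ (N ^ deg_exp)) *
      A ^ (card X * N ^ deg_exp * l) \<le> N ^ (rep_const * N ^ (ord_exp + J))"
    unfolding L_def U_def .
qed

lemma norm_aux_term':
  assumes N: "5 \<le> N" "A \<le> N" and J: "J \<le> steps" and m: "sum m X \<le> (steps + 1) * N ^ ord_exp"
    and z: "norm z \<le> 5 * real (N ^ (J + 2))" and u: "u \<in> index (N ^ deg_exp)"
  shows "norm (aux_term m u z) \<le> real (N ^ (growth_const * N ^ (ord_exp + J)))"
proof -
  define L where "L = N ^ deg_exp"
  define U where "U = N ^ (ord_exp + J)"
  define r where "r = 5 * N ^ (J + 2)"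
  note sb = size_bounds[OF N J m, folded L_def U_def]
  have N0: "N > 0" using N by simp
  have f1: "L + 1 \<le> N ^ ((deg_exp + 1) * U)"
  proof (rule order.trans[OF sb(1)])
    show "N ^ (deg_exp + 1) \<le> N ^ ((deg_exp + 1) * U)"
      using mult_le_mono2[OF sb(2), of "deg_exp + 1"] N0 by (intro power_increasing) auto
  qed
  \<comment> \<open>One factor \<open>N\<close> absorbs \<open>A\<close>, another the 5 in the
    radius.\<close>
  have "A * r \<le> N * (N * N ^ (J + 2))" unfolding r_def using N by (intro mult_le_mono) auto
  also have "\<dots> = N ^ (J + 4)" by (simp add: power_add power4_eq_xxxx power2_eq_square)
  finally have f2: "(A * r) ^ L \<le> N ^ ((steps + 4) * U)" by (rule sb(6))
  have "exp (1 :: real) \<le> real N" using exp_le N by linarith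
  then have "exp (1 :: real) ^ (5 * n * A * U) \<le> real N ^ (5 * n * A * U)" by (intro power_mono) auto
  moreover have "exp (real r * (card X * L * A)) = exp (1 :: real) ^ (5 * n * A * U)"
  proof -
    have "real r * (real (card X * L * A)) = real (5 * n * A * U) * 1"
      unfolding r_def sb(7)[symmetric] n_def by (simp add: algebra_simps)
    then show ?thesis by (simp only: exp_of_nat_mult)
  qed
  ultimately have f3: "exp (real r * (card X * L * A)) \<le> real (N ^ (5 * n * A * U))" by simp
  have "norm (aux_term m u z) \<le>
    real (L + 1) * (real ((L + A) ^ sum m X) * real (L + 1) ^ L * (real A * real r) ^ L) * exp (real r * (card X * L * A))"
  proof (rule norm_aux_term)
    have "1 \<le> r" using N0 by (simp add: r_def Suc_le_eq)
    then show "1 \<le> real r" by simp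
  qed (use z u in \<open>auto simp: r_def L_def\<close>)
  also have "\<dots> = real ((L + 1) * ((L + A) ^ sum m X * (L + 1) ^ L * (A * r) ^ L)) * exp (real r * (card X * L * A))"
    by (simp only: of_nat_mult of_nat_power)
  also have "\<dots> \<le> real (N ^ ((deg_exp + 1) * U) * (N ^ ((deg_exp + 1) * (steps + 1) * U) * N ^ ((deg_exp + 1) * U) * N ^ ((steps + 4) * U)))
      * real (N ^ (5 * n * A * U))"
    by (intro mult_mono of_nat_mono mult_le_mono f1 f2 f3 sb(4,5)) auto
  also have "\<dots> = real (N ^ (growth_const * U))"
    unfolding of_nat_mult[symmetric] of_nat_eq_iff
    by (simp only: growth_const_def power_add[symmetric]) (rule arg_cong[where f = "\<lambda>e. N ^ e"], simp add: algebra_simps)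
  finally show ?thesis unfolding U_def .
qed

lemma card_index_le:
  assumes "5 \<le> N" "A \<le> N" "1 \<le> U"
  shows "card (index (N ^ deg_exp)) \<le> N ^ ((deg_exp + 1) * (n + 1) * U)"
proof -
  have "card (index (N ^ deg_exp)) = (N ^ deg_exp + 1) ^ (n + 1)" by (simp add: card_index n_def)
  also have "\<dots> \<le> (N ^ (deg_exp + 1)) ^ (n + 1)"
    using size_bounds(1)[of N 0 0] assms by (intro power_mono) auto
  also have "\<dots> = N ^ ((deg_exp + 1) * (n + 1))" by (simp only: power_mult)
  also have "\<dots> \<le> N ^ ((deg_exp + 1) * (n + 1) * U)"
    using assms mult_le_mono2[OF assms(3), of "(deg_exp + 1) * (n + 1)"] by (intro power_increasing) auto
  finally show ?thesis .
qed

text \<open>A nonzero value would be at most \<open>N ^ (total_const * U) / 2 ^ (N * U)\<close> by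
  the Schwarz lemma and at least a negative power \<open>N ^ (c * U)\<close> with constant c by the
  Liouville inequality. Taking \<open>U\<close>-th roots contradicts
  \<open>N ^ final_const < 2 ^ N\<close>.\<close>

lemma extrapolation_step:
  assumes N: "5 \<le> N" "A \<le> N" "N ^ final_const < 2 ^ N" and J: "J < steps"
    and p: "\<And>u. u \<in> index (N ^ deg_exp) \<Longrightarrow> \<bar>p u\<bar> \<le> int (N ^ (coeff_const * N ^ ord_exp))"
    and zero: "\<And>m l. sum m X \<le> (steps + 1 - J) * N ^ ord_exp \<Longrightarrow> 1 \<le> l \<Longrightarrow> l \<le> N ^ (J + 1) \<Longrightarrow>
      aux (N ^ deg_exp) p m (of_nat l) = 0"
    and m: "sum m X \<le> (steps - J) * N ^ ord_exp" and l: "1 \<le> l" "l \<le> N ^ (J + 2)"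
  shows "aux (N ^ deg_exp) p m (of_nat l) = 0"
proof (rule ccontr)
  assume nz: "aux (N ^ deg_exp) p m (of_nat l) \<noteq> 0"
  define L where "L = N ^ deg_exp"
  define U where "U = N ^ (ord_exp + J)"
  define x where "x = aux L p m (of_nat l)"
  have N0: "N > 0" using N by simp
  have U: "U \<ge> 1" using N0 by (simp add: U_def)
  have J': "J \<le> steps" using J by simp
  have "(steps - J) * N ^ ord_exp \<le> (steps + 1) * N ^ ord_exp" by (intro mult_right_mono) auto
  then have m': "sum m X \<le> (steps + 1) * N ^ ord_exp" using m by linarith
  have pU: "nat \<bar>p u\<bar> \<le> N ^ (coeff_const * U)" if "u \<in> index L" for u
  proof -
    have "nat \<bar>p u\<bar> \<le> N ^ (coeff_const * N ^ ord_exp)" using p[of u] that unfolding L_def nat_le_iff by blast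
    also have "\<dots> \<le> N ^ (coeff_const * U)" unfolding U_def using N0
      by (intro power_increasing mult_le_mono) auto
    finally show ?thesis .
  qed
  have rep: "zrep V (N ^ (total_const * U)) x"
  proof (rule zrep_mono)
    show "zrep V (\<Sum>u\<in>index L. nat \<bar>p u\<bar> * N ^ (rep_const * U)) x"
      unfolding x_def aux_def U_def L_def
      by (intro zrep_sum zrep_mult zrep_of_int finite_V zrep_aux_term' N J' m' l)
    have "(\<Sum>u\<in>index L. nat \<bar>p u\<bar> * N ^ (rep_const * U)) \<le> (\<Sum>u\<in>index L. N ^ (coeff_const * U) * N ^ (rep_const * U))"
      by (intro sum_mono mult_le_mono pU) auto
    also have "\<dots> = card (index L) * (N ^ (coeff_const * U) * N ^ (rep_const * U))" by simp
    also have "\<dots> \<le> N ^ ((deg_exp + 1) * (n + 1) * U) * (N ^ (coeff_const * U) * N ^ (rep_const * U))"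
      unfolding L_def by (intro mult_le_mono card_index_le N U) auto
    also have "\<dots> = N ^ (((deg_exp + 1) * (n + 1) + coeff_const + rep_const) * U)"
      by (simp only: power_add[symmetric]) (simp only: algebra_simps)
    also have "\<dots> \<le> N ^ (total_const * U)"
      using N0 by (intro power_increasing mult_le_mono) (auto simp: total_const_def)
    finally show "(\<Sum>u\<in>index L. nat \<bar>p u\<bar> * N ^ (rep_const * U)) \<le> N ^ (total_const * U)" .
  qed
  have growth: "norm (aux L p m z) \<le> real (N ^ (total_const * U))" if z: "norm z \<le> 5 * real (N ^ (J + 2))" for z
  proof -
    have "norm (aux L p m z) \<le> (\<Sum>u\<in>index L. real (N ^ (coeff_const * U)) * real (N ^ (growth_const * U)))"
      unfolding aux_def
    proof (rule sum_norm_le)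
      fix u assume u: "u \<in> index L"
      have "\<bar>p u\<bar> \<le> int (N ^ (coeff_const * U))" using pU[OF u] by linarith
      then have "\<bar>real_of_int (p u)\<bar> \<le> real (N ^ (coeff_const * U))"
        by (metis of_int_abs of_int_le_iff of_int_of_nat_eq)
      then show "norm (of_int (p u) * aux_term m u z) \<le> real (N ^ (coeff_const * U)) * real (N ^ (growth_const * U))"
        unfolding norm_mult norm_of_int
        using norm_aux_term'[OF N(1,2) J' m' z u[unfolded L_def]] unfolding U_def by (intro mult_mono) auto
    qed
    also have "\<dots> = real (card (index L) * (N ^ (coeff_const * U) * N ^ (growth_const * U)))" by simp
    also have "\<dots> \<le> real (N ^ ((deg_exp + 1) * (n + 1) * U) * (N ^ (coeff_const * U) * N ^ (growth_const * U)))"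
      unfolding L_def by (intro of_nat_mono mult_le_mono card_index_le N U) auto
    also have "\<dots> = real (N ^ (((deg_exp + 1) * (n + 1) + coeff_const + growth_const) * U))"
      by (simp only: power_add[symmetric]) (simp only: algebra_simps)
    also have "\<dots> \<le> real (N ^ (total_const * U))"
      using N0 by (intro of_nat_mono power_increasing mult_le_mono) (auto simp: total_const_def)
    finally show ?thesis .
  qed
  have small: "norm x * 2 ^ (N ^ (J + 1) * N ^ ord_exp) \<le> real (N ^ (total_const * U))"
    unfolding x_def
  proof (rule entire_small_if_many_zeros[OF holomorphic_aux, where r = "real (N ^ (J + 2))"])
    show "(deriv ^^ t) (aux L p m) (of_nat l') = 0" if "1 \<le> l'" "l' \<le> N ^ (J + 1)" "t < N ^ ord_exp" for l' t
    proof (rule higher_deriv_aux_eq_0)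
      fix m' assume "sum m' X \<le> sum m X + t"
      \<comment> \<open>One block of \<open>N ^ ord_exp\<close> orders is given up here, in exchange
        for zeros of that multiplicity on the line.\<close>
      also have "\<dots> \<le> (steps - J) * N ^ ord_exp + 1 * N ^ ord_exp" using m that(3) by simp
      also have "\<dots> = (steps + 1 - J) * N ^ ord_exp" 
        using J by (simp only: distrib_right[symmetric]) (simp add: Suc_diff_le)
      finally show "aux L p m' (of_nat l') = 0" unfolding L_def using that by (intro zero)
    qed
    show "real (N ^ (J + 1)) \<le> real (N ^ (J + 2))" using N0 by (intro of_nat_mono power_increasing) auto
    show "0 < real (N ^ (J + 2))" using N0 by simp
    show "norm (of_nat l :: complex) \<le> real (N ^ (J + 2))" using l by (simp only: norm_of_nat of_nat_le_iff)
  qed (rule growth)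
  \<comment> \<open>The decisive comparison: \<open>N * U\<close> zeros against growth and height of
    order \<open>U\<close>.\<close>
  have NU: "N ^ (J + 1) * N ^ ord_exp = N * U" by (simp add: U_def power_add mult_ac)
  note small = small[unfolded NU]
  let ?D = "card V"
  have "1 \<le> norm x * real (10 * ?D ^ 2 * (N ^ (total_const * U)) ^ (2 * ?D))"
    using nz N0 by (intro zrep_lower_bound finite_V one_in_V rep) (auto simp: x_def L_def)
  also have "real (10 * ?D ^ 2 * (N ^ (total_const * U)) ^ (2 * ?D)) \<le> real (N ^ (10 * ?D ^ 2 * U) * (N ^ (total_const * U)) ^ (2 * ?D))"
  proof (intro of_nat_mono mult_le_mono)
    have "10 * ?D ^ 2 \<le> 2 ^ (10 * ?D ^ 2)" by (rule less_imp_le[OF less_exp])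
    also have "\<dots> \<le> N ^ (10 * ?D ^ 2)" using N by (intro power_mono) auto
    also have "\<dots> \<le> N ^ (10 * ?D ^ 2 * U)" using N0 U by (intro power_increasing) auto
    finally show "10 * ?D ^ 2 \<le> N ^ (10 * ?D ^ 2 * U)" .
  qed simp
  also have "N ^ (10 * ?D ^ 2 * U) * (N ^ (total_const * U)) ^ (2 * ?D) = N ^ ((total_const * (2 * ?D) + 10 * ?D ^ 2) * U)"
    by (simp only: power_mult[symmetric] power_add[symmetric]) (rule arg_cong[where f = "\<lambda>e. N ^ e"], simp add: algebra_simps)
  finally have "1 \<le> norm x * real (N ^ ((total_const * (2 * ?D) + 10 * ?D ^ 2) * U))" by (simp add: mult_left_mono)
  then have "2 ^ (N * U) \<le> (norm x * real (N ^ ((total_const * (2 * ?D) + 10 * ?D ^ 2) * U))) * 2 ^ (N * U)"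
    by simp
  also have "\<dots> = (norm x * 2 ^ (N * U)) * real (N ^ ((total_const * (2 * ?D) + 10 * ?D ^ 2) * U))" by (simp only: mult_ac)
  also have "\<dots> \<le> real (N ^ (total_const * U)) * real (N ^ ((total_const * (2 * ?D) + 10 * ?D ^ 2) * U))"
    by (intro mult_right_mono small) auto
  also have "\<dots> = real ((N ^ final_const) ^ U)"
    unfolding of_nat_mult[symmetric] of_nat_eq_iff
    by (simp only: power_mult[symmetric] power_add[symmetric]) (rule arg_cong[where f = "\<lambda>e. N ^ e"], simp add: final_const_def algebra_simps)
  finally have "real ((2 ^ N) ^ U) \<le> real ((N ^ final_const) ^ U)" by (simp add: power_mult)
  then have "(2 ^ N) ^ U \<le> (N ^ final_const) ^ U" by (simp only: of_nat_le_iff)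
  moreover have "(N ^ final_const) ^ U < (2 ^ N) ^ U" using N(3) U by (intro power_strict_mono) auto
  ultimately show False by simp
qed

lemma extrapolation:
  assumes N: "5 \<le> N" "A \<le> N" "N ^ final_const < 2 ^ N"
    and p: "\<And>u. u \<in> index (N ^ deg_exp) \<Longrightarrow> \<bar>p u\<bar> \<le> int (N ^ (coeff_const * N ^ ord_exp))"
    and zero: "\<And>m l. sum m X \<le> (steps + 1) * N ^ ord_exp \<Longrightarrow> 1 \<le> l \<Longrightarrow> l \<le> N \<Longrightarrow>
      aux (N ^ deg_exp) p m (of_nat l) = 0"
    and "J \<le> steps" "sum m X \<le> (steps + 1 - J) * N ^ ord_exp" "1 \<le> l" "l \<le> N ^ (J + 1)"
  shows "aux (N ^ deg_exp) p m (of_nat l) = 0"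
  using assms(6-)
proof (induction J arbitrary: m l)
  case 0
  then show ?case using zero[of m l] by simp
next
  case (Suc J)
  show ?case
    by (rule extrapolation_step[OF N _ p Suc.IH]) (use Suc.prems in \<open>auto simp del: power_Suc\<close>)
qed

text \<open>Siegel's lemma needs a finite set of equations, hence extensional orders
  \<open>m\<close>; this transfers its result to arbitrary functions \<open>m\<close>.\<close>

lemma aux_restrict: "aux L p (restrict m X) z = aux L p m z"
proof -
  have "oper (restrict m X) \<mu> = oper m \<mu>" for \<mu> unfolding oper_def by (intro prod.cong) auto
  then show ?thesis by (simp add: aux_def aux_term_def)
qed

lemma exists_aux:
  assumes N: "5 \<le> N" "A \<le> N" "2 * card V * (steps + 2) ^ n \<le> N"
  obtains p where "\<exists>u\<in>index (N ^ deg_exp). p u \<noteq> 0"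
    "\<And>u. u \<in> index (N ^ deg_exp) \<Longrightarrow> \<bar>p u\<bar> \<le> int (N ^ (coeff_const * N ^ ord_exp))"
    "\<And>m l. sum m X \<le> (steps + 1) * N ^ ord_exp \<Longrightarrow> 1 \<le> l \<Longrightarrow> l \<le> N \<Longrightarrow>
      aux (N ^ deg_exp) p m (of_nat l) = 0"
proof -
  define T where "T = (steps + 1) * N ^ ord_exp"
  define E where "E = {m \<in> PiE X (\<lambda>_. {..T}). sum m X \<le> T} \<times> {1..N}"
  define U where "U = index (N ^ deg_exp)"
  define B where "B = N ^ (rep_const * N ^ (ord_exp + 0))"
  have N0: "N > 0" using N by simp
  have finP: "finite (PiE X (\<lambda>_. {..T}))" using finite_X by (auto intro: finite_PiE)
  have finE: "finite E" unfolding E_def using finP by auto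
  have cE: "card E \<le> (T + 1) ^ n * N"
  proof -
    have "card {m \<in> PiE X (\<lambda>_. {..T}). sum m X \<le> T} \<le> card (PiE X (\<lambda>_. {..T}))"
      using finP by (intro card_mono) auto
    then show ?thesis using finite_X by (simp add: E_def card_cartesian_product card_PiE n_def)
  qed
  have card: "2 * (card E * card V) \<le> card U"
  proof -
    have "T + 1 \<le> (steps + 2) * N ^ ord_exp" using N0 by (simp add: T_def Suc_le_eq)
    then have "2 * (card E * card V) \<le> 2 * (((steps + 2) * N ^ ord_exp) ^ n * N * card V)"
      using cE by (intro mult_le_mono le_trans[OF cE] power_mono) auto
    also have "\<dots> = (2 * card V * (steps + 2) ^ n) * (N ^ (ord_exp * n) * N)"
      unfolding power_mult_distrib power_mult[of N ord_exp n] by (simp only: mult_ac)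
    also have "\<dots> \<le> N * (N ^ (ord_exp * n) * N)" by (intro mult_le_mono N) auto
    also have "\<dots> = N ^ (deg_exp * (n + 1))" 
    proof -
      \<comment> \<open>Up to constants there are \<open>N ^ (ord_exp * n)\<close> orders and
        \<open>N\<close> points. The second spare factor \<open>N\<close> absorbs the constant
        \<open>2 * card V * (steps + 2) ^ n\<close>.\<close>
      have e: "deg_exp * (n + 1) = ord_exp * n + 1 + 1" by (simp add: deg_exp_def ord_exp_def algebra_simps)
      show ?thesis unfolding e power_add by simp
    qed
    also have "\<dots> \<le> (N ^ deg_exp + 1) ^ (n + 1)" unfolding power_mult by (intro power_mono) auto
    also have "\<dots> = card U" by (simp add: U_def card_index n_def)
    finally show ?thesis .
  qed
  have "U \<noteq> {}"
  proof -
    have "card U > 0" unfolding U_def card_index by simp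
    then show ?thesis by auto
  qed
  moreover have "zrep V B (aux_term (fst e) u (of_nat (snd e)))" if "e \<in> E" "u \<in> U" for e u
    unfolding B_def
  proof (rule zrep_aux_term'[OF N(1,2)])
    show "snd e \<le> N ^ (0 + 2)" using that by (auto simp: E_def power2_eq_square intro: le_trans[OF _ le_square])
  qed (use that in \<open>auto simp: E_def U_def T_def\<close>)
  ultimately obtain p where p: "\<exists>u\<in>U. p u \<noteq> 0" "\<And>u. u \<in> U \<Longrightarrow> \<bar>p u\<bar> \<le> int (2 * card U * B + 1)"
     "\<And>e. e \<in> E \<Longrightarrow> (\<Sum>u\<in>U. of_int (p u) * aux_term (fst e) u (of_nat (snd e))) = 0"
    using card finE finite_index unfolding U_def
    by - (rule zrep_relations[OF finite_V one_in_V, of E "index (N ^ deg_exp)" B "\<lambda>e u. aux_term (fst e) u (of_nat (snd e))"], auto)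
  show thesis
  proof (rule that[of p])
    show "\<exists>u\<in>index (N ^ deg_exp). p u \<noteq> 0" using p(1) by (simp add: U_def)
    have "2 * card U * B + 1 \<le> N ^ (coeff_const * N ^ ord_exp)"
    proof -
      have P: "1 \<le> N ^ ord_exp" using N0 by simp
      have "card U > 0" "B > 0" unfolding U_def card_index B_def using N0 by auto
      then have "2 * card U * B + 1 \<le> 3 * (card U * B)" by (simp add: Suc_le_eq)
      also have "\<dots> \<le> N ^ (1 * N ^ ord_exp) * (N ^ ((deg_exp + 1) * (n + 1) * N ^ ord_exp) * B)"
      proof (intro mult_le_mono)
        have "3 \<le> N ^ 1" using N by simp
        also have "\<dots> \<le> N ^ (1 * N ^ ord_exp)" using N0 by (intro power_increasing) auto
        finally show "3 \<le> N ^ (1 * N ^ ord_exp)" .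
        show "card U \<le> N ^ ((deg_exp + 1) * (n + 1) * N ^ ord_exp)"
          unfolding U_def by (rule card_index_le[OF N(1,2) P])
      qed simp
      also have "\<dots> = N ^ (coeff_const * N ^ ord_exp)"
        unfolding B_def coeff_const_def add_0_right 
          by (simp only: power_add[symmetric]) (simp only: algebra_simps)
      finally show ?thesis .
    qed
    then show "\<bar>p u\<bar> \<le> int (N ^ (coeff_const * N ^ ord_exp))" if "u \<in> index (N ^ deg_exp)" for u
      using p(2)[of u] that unfolding U_def by (meson of_nat_mono order_trans)
    fix m l assume m: "sum m X \<le> (steps + 1) * N ^ ord_exp" and l: "1 \<le> l" "l \<le> N"
    have "m x \<le> T" if "x \<in> X" for x using member_le_sum[of x X m] that finite_X m by (simp add: T_def)
    moreover have "sum (restrict m X) X = sum m X" by (intro sum.cong) auto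
    ultimately have "(restrict m X, l) \<in> E" using m l by (auto simp: E_def T_def)
    from p(3)[OF this] have "aux (N ^ deg_exp) p (restrict m X) (of_nat l) = 0" by (simp add: aux_def U_def)
    then show "aux (N ^ deg_exp) p m (of_nat l) = 0" by (simp add: aux_restrict)
  qed
qed

end

subsection \<open>The zero estimate\<close>

definition diff_poly :: "nat \<Rightarrow> complex poly \<Rightarrow> complex poly" where
  "diff_poly k Q = (\<Sum>j\<le>k. monom (coeff Q j * of_nat ((k choose j) * fact j)) (k - j))"

lemma poly_diff_poly: "poly (diff_poly k Q) s = diff_eval k s Q"
  by (simp add: diff_poly_def diff_eval_def poly_sum poly_monom)

lemma degree_diff_poly: "degree (diff_poly k Q) \<le> k"
  unfolding diff_poly_def by (intro degree_sum_le order.trans[OF degree_monom_le]) auto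

text \<open>Differentiation lowers the degree, so only the constant term of \<open>Q\<close>
  contributes. For the powers \<open>[:of_nat i, \<beta> \<omega>:] ^ M\<close> below it is
  \<open>i ^ M\<close>, the source of the power sums.\<close>

lemma coeff_diff_poly_top: "coeff (diff_poly k Q) k = coeff Q 0"
proof -
  have "coeff (diff_poly k Q) k = (\<Sum>j\<le>k. if j = 0 then coeff Q 0 else 0)"
    unfolding diff_poly_def coeff_sum by (intro sum.cong) auto
  then show ?thesis by simp
qed

context log_linear_form
begin

abbreviation "\<omega> \<equiv> 2 * of_real pi * \<i> :: complex"

text \<open>Since \<open>exp \<omega> = 1\<close>, the values of the auxiliary function at integers do not see the exponent
  of \<open>exp \<omega>\<close>. It is recovered from the derivatives in the direction \<open>\<omega>\<close>, whose leading coefficients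
  are power sums.\<close>

lemma aux_eq_0_imp_coeff_eq_0:
  assumes \<omega>: "\<omega> \<in> X" and form: "form \<noteq> 0"
    and indep: "\<And>c :: complex \<Rightarrow> int. exp (\<Sum>x\<in>X - {\<omega>}. of_int (c x) * x) = 1 \<Longrightarrow> \<forall>x\<in>X - {\<omega>}. c x = 0"
    and zero: "\<And>m l. sum m X \<le> L \<Longrightarrow> 1 \<le> l \<Longrightarrow> l \<le> (L + 1) ^ n \<Longrightarrow> aux L p m (of_nat l) = 0"
    and u: "u \<in> index L"
  shows "p u = 0"
proof -
  define Y where "Y = X - {\<omega>}"
  define I where "I = PiE Y (\<lambda>_. {..L})"
  define E where "E \<nu> = exp (\<Sum>x\<in>Y. of_nat (\<nu> x) * x)" for \<nu> :: "complex \<Rightarrow> nat"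
  \<comment> \<open>All terms with the same exponents \<open>\<nu>\<close> away from
    \<open>\<omega>\<close> share the exponential \<open>E \<nu> ^ l\<close>; at
    \<open>form * l\<close> this polynomial is its total coefficient.\<close>
  define S where "S M \<nu> = (\<Sum>k\<le>L. \<Sum>i\<le>L. smult (of_int (p (k, \<nu>(\<omega> := i)))) (diff_poly k ([:of_nat i, \<beta> \<omega>:] ^ M)))" for M \<nu>
  have X: "X = insert \<omega> Y" "\<omega> \<notin> Y" "finite Y" using \<omega> finite_X by (auto simp: Y_def)
  have finI: "finite I" unfolding I_def using X by (auto intro: finite_PiE)
  have exp\<omega>: "exp (of_nat a * \<omega>) = 1" for a
    using exp_eq_1[of "of_nat a * \<omega>"] by (auto intro!: exI[of _ "int a"])
  have injE: "inj_on E I"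
  proof (rule inj_onI)
    fix \<nu> \<nu>' assume *: "\<nu> \<in> I" "\<nu>' \<in> I" "E \<nu> = E \<nu>'"
    have "exp (\<Sum>x\<in>Y. of_int (int (\<nu> x) - int (\<nu>' x)) * x) = E \<nu> / E \<nu>'"
      by (simp add: E_def algebra_simps sum_subtractf exp_diff)
    also have "\<dots> = 1" using *(3) by (simp add: E_def)
    finally have "\<forall>x\<in>Y. int (\<nu> x) - int (\<nu>' x) = 0" unfolding Y_def by (rule indep)
    then show "\<nu> = \<nu>'" using *(1,2) unfolding I_def by (intro PiE_ext) auto
  qed
  have S0: "S M \<nu> = 0" if M: "M \<le> L" and \<nu>: "\<nu> \<in> I" for M \<nu>
  proof -
    define R where "R \<nu> = pcompose (S M \<nu>) [:0, form:]" for \<nu>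
    \<comment> \<open>Differentiation in the direction \<open>\<omega>\<close> only, so that
      \<open>oper\<close> sees no exponent but that of \<open>exp \<omega>\<close>.\<close>
    define m where "m x = (if x = \<omega> then M else 0)" for x
    have sm: "sum m X \<le> L" using M finite_X \<omega> by (simp add: m_def)
    have oper: "oper m \<mu> = [:of_nat (\<mu> \<omega>), \<beta> \<omega>:] ^ M" for \<mu>
    proof -
      have "(\<Prod>x\<in>Y. [:of_nat (\<mu> x), \<beta> x:] ^ m x) = 1" using X(2) by (intro prod.neutral) (auto simp: m_def)
      moreover have "oper m \<mu> = [:of_nat (\<mu> \<omega>), \<beta> \<omega>:] ^ m \<omega> * (\<Prod>x\<in>Y. [:of_nat (\<mu> x), \<beta> x:] ^ m x)"
        unfolding oper_def by (subst X(1)) (rule prod.insert[OF X(3,2)])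
      ultimately show ?thesis by (simp add: m_def)
    qed
    have aux_eq: "aux L p m (of_nat l) = (\<Sum>\<nu>\<in>I. poly (R \<nu>) (of_nat l) * E \<nu> ^ l)" for l
    proof -
      have ind: "index L = {..L} \<times> (\<lambda>(i, \<nu>). \<nu>(\<omega> := i)) ` ({..L} \<times> I)"
        unfolding index_def by (subst X(1)) (simp only: PiE_insert_eq I_def)
      have inj: "inj_on (\<lambda>(i, \<nu>). \<nu>(\<omega> := i)) ({..L} \<times> I)"
      proof (rule inj_onI, clarify)
        fix i \<nu> i' \<nu>' assume *: "\<nu> \<in> I" "\<nu>' \<in> I" "\<nu>(\<omega> := i) = \<nu>'(\<omega> := i')"
        have "\<nu> x = \<nu>' x" if "x \<in> Y" for x using fun_cong[OF *(3), of x] that X(2) by (auto split: if_splits)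
        then have "\<nu> = \<nu>'" using *(1,2) unfolding I_def by (intro PiE_ext) auto
        then show "i = i' \<and> \<nu> = \<nu>'" using fun_cong[OF *(3), of \<omega>] by simp
      qed
      have term_eq: "aux_term m (k, \<nu>(\<omega> := i)) (of_nat l) =
          poly (diff_poly k ([:of_nat i, \<beta> \<omega>:] ^ M)) (form * of_nat l) * E \<nu> ^ l" for k i \<nu>
      proof -
        have "(\<Sum>x\<in>X. of_nat ((\<nu>(\<omega> := i)) x) * x) = of_nat i * \<omega> + (\<Sum>x\<in>Y. of_nat (\<nu> x) * x)"
        proof -
          have "(\<Sum>x\<in>Y. of_nat ((\<nu>(\<omega> := i)) x) * x) = (\<Sum>x\<in>Y. of_nat (\<nu> x) * x)"
            using X(2) by (intro sum.cong) auto
          then show ?thesis by (subst X(1)) (simp add: X(2,3))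
        qed
        then have "exp (of_nat l * (\<Sum>x\<in>X. of_nat ((\<nu>(\<omega> := i)) x) * x)) = exp (of_nat i * \<omega>) ^ l * E \<nu> ^ l"
          unfolding exp_of_nat_mult[of l] E_def by (simp only: exp_add power_mult_distrib)
        then show ?thesis by (simp only: aux_term_def fst_conv snd_conv oper fun_upd_same exp\<omega> poly_diff_poly power_one mult_1_left)
      qed
      define J where "J = (\<lambda>(i, \<nu>). \<nu>(\<omega> := i)) ` ({..L} \<times> I)"
      define f where "f k \<mu> = of_int (p (k, \<mu>)) * aux_term m (k, \<mu>) (of_nat l)" for k \<mu>
      have reindex: "(\<Sum>\<mu>\<in>J. g \<mu>) = (\<Sum>i\<le>L. \<Sum>\<nu>\<in>I. g (\<nu>(\<omega> := i)))" for g :: "_ \<Rightarrow> complex"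
        unfolding J_def sum.reindex[OF inj] sum.cartesian_product by (simp add: case_prod_unfold)
      have "aux L p m (of_nat l) = (\<Sum>k\<le>L. \<Sum>\<mu>\<in>J. f k \<mu>)"
        unfolding aux_def ind J_def[symmetric] sum.cartesian_product by (simp add: case_prod_unfold f_def)
      also have "\<dots> = (\<Sum>k\<le>L. \<Sum>i\<le>L. \<Sum>\<nu>\<in>I. of_int (p (k, \<nu>(\<omega> := i))) * aux_term m (k, \<nu>(\<omega> := i)) (of_nat l))"
        unfolding reindex f_def ..
      also have "\<dots> = (\<Sum>\<nu>\<in>I. \<Sum>k\<le>L. \<Sum>i\<le>L. of_int (p (k, \<nu>(\<omega> := i))) * aux_term m (k, \<nu>(\<omega> := i)) (of_nat l))"
        by (simp only: sum.swap[of _ "{..L}" I])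
      also have "\<dots> = (\<Sum>\<nu>\<in>I. poly (R \<nu>) (of_nat l) * E \<nu> ^ l)"
        unfolding term_eq R_def S_def
        by (simp add: poly_pcompose poly_sum sum_distrib_right mult.assoc mult.commute[of form])
      finally show ?thesis .
    qed
    have degS: "degree (S M \<nu>) \<le> L" for \<nu>
      unfolding S_def by (intro degree_sum_le order.trans[OF degree_smult_le] order.trans[OF degree_diff_poly]) auto
    have "degree (R \<nu>) \<le> L" for \<nu>
      unfolding R_def using degS[of \<nu>] form by (simp add: degree_pcompose)
    then have "(\<Sum>\<nu>\<in>I. if R \<nu> = 0 then 0 else Suc (degree (R \<nu>))) \<le> (\<Sum>\<nu>\<in>I. L + 1)"
      by (intro sum_mono) auto
    \<comment> \<open>There are \<open>(L + 1) ^ (n - 1)\<close> exponent vectors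
      \<open>\<nu>\<close>, each with a polynomial of at most \<open>L + 1\<close>
      coefficients.\<close>
    also have "\<dots> = (L + 1) ^ n"
    proof -
      have "n = Suc (card Y)" unfolding n_def by (subst X(1)) (simp add: X(2,3))
      then show ?thesis using X(3) by (simp add: I_def card_PiE)
    qed
    finally have size: "(\<Sum>\<nu>\<in>I. if R \<nu> = 0 then 0 else Suc (degree (R \<nu>))) \<le> (L + 1) ^ n" .
    have "R \<nu> = 0"
    proof (rule exponential_polynomial_eq_0[OF finI injE _ size _ \<nu>])
      show "E \<nu> \<noteq> 0" for \<nu> by (simp add: E_def)
      show "(\<Sum>\<nu>\<in>I. poly (R \<nu>) (of_nat l) * E \<nu> ^ l) = 0" if "1 \<le> l" "l \<le> (L + 1) ^ n" for l
        using zero[OF sm that] by (simp only: aux_eq)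
    qed
    then show ?thesis unfolding R_def using form by (subst (asm) pcompose_eq_0_iff) auto
  qed
  obtain k0 \<mu> where u_eq: "u = (k0, \<mu>)" "k0 \<le> L" "\<mu> \<in> PiE X (\<lambda>_. {..L})" using u by (auto simp: index_def)
  define \<nu> where "\<nu> = restrict \<mu> Y"
  have \<nu>: "\<nu> \<in> I" using u_eq(3) X(1) by (auto simp: \<nu>_def I_def PiE_iff)
  have \<mu>: "\<mu> = \<nu>(\<omega> := \<mu> \<omega>)" "\<mu> \<omega> \<le> L"
    using u_eq(3) X by (auto simp: \<nu>_def PiE_iff extensional_def fun_eq_iff)
  have "\<forall>i\<le>L. p (k, \<nu>(\<omega> := i)) = 0" if "k \<le> L" for k
  proof (rule ccontr)
    assume "\<not> ?thesis"
    then have ex: "k \<in> {k. k \<le> L \<and> (\<exists>i\<le>L. p (k, \<nu>(\<omega> := i)) \<noteq> 0)}" using that by auto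
    \<comment> \<open>At the largest degree that occurs, neither lower nor higher \<open>k\<close>
      contributes to the coefficient of \<open>S M \<nu>\<close>, which isolates a pure power sum in
      \<open>i\<close>.\<close>
    define K where "K = Max {k. k \<le> L \<and> (\<exists>i\<le>L. p (k, \<nu>(\<omega> := i)) \<noteq> 0)}"
    have "K \<in> {k. k \<le> L \<and> (\<exists>i\<le>L. p (k, \<nu>(\<omega> := i)) \<noteq> 0)}"
      unfolding K_def using ex by (intro Max_in) auto
    then obtain i where K: "K \<le> L" "i \<le> L" "p (K, \<nu>(\<omega> := i)) \<noteq> 0" by auto
    have max: "p (k, \<nu>(\<omega> := i)) = 0" if "k \<le> L" "K < k" "i \<le> L" for k i
    proof (rule ccontr)
      assume "\<not> ?thesis"
      then have "k \<le> K" unfolding K_def using that by (intro Max_ge) auto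
      then show False using that by simp
    qed
    have "(\<Sum>i\<le>L. of_int (p (K, \<nu>(\<omega> := i))) * of_nat i ^ M) = (0 :: complex)" if M: "M \<le> L" for M
    proof -
      have "0 = coeff (S M \<nu>) K" using S0[OF M \<nu>] by simp
      also have "\<dots> = (\<Sum>k\<le>L. \<Sum>i\<le>L. of_int (p (k, \<nu>(\<omega> := i))) * coeff (diff_poly k ([:of_nat i, \<beta> \<omega>:] ^ M)) K)"
        by (simp add: S_def coeff_sum)
      also have "\<dots> = (\<Sum>k\<le>L. if k = K then \<Sum>i\<le>L. of_int (p (K, \<nu>(\<omega> := i))) * of_nat i ^ M else 0)"
      proof (intro sum.cong refl)
        fix k assume k: "k \<in> {..L}"
        consider "k = K" | "k < K" | "K < k" by linarith
        then show "(\<Sum>i\<le>L. of_int (p (k, \<nu>(\<omega> := i))) * coeff (diff_poly k ([:of_nat i, \<beta> \<omega>:] ^ M)) K) =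
            (if k = K then \<Sum>i\<le>L. of_int (p (K, \<nu>(\<omega> := i))) * of_nat i ^ M else 0)"
        proof cases
          case 2
          then have "coeff (diff_poly k Q) K = 0" for Q using degree_diff_poly[of k Q] by (intro coeff_eq_0) auto
          then show ?thesis using 2 by simp
        qed (use k max in \<open>simp_all add: coeff_diff_poly_top coeff_0_power\<close>)
      qed
      also have "\<dots> = (\<Sum>i\<le>L. of_int (p (K, \<nu>(\<omega> := i))) * of_nat i ^ M)" using K(1) by simp
      finally show ?thesis by simp
    qed
    from power_sums_eq_0_imp_eq_0[OF this K(2)] K(3) show False by simp
  qed
  from this[OF u_eq(2)] show ?thesis using \<mu> u_eq(1) by metis
qed

text \<open>At \<open>J = steps\<close> the order still reaches \<open>N ^ ord_exp \<ge> L\<close>,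
  and since \<open>steps = (deg_exp + 1) * n\<close> the points reach \<open>(L + 1) ^ n\<close>, as
  the zero estimate requires. So a nonzero form forces a multiplicative relation between the
  \<open>exp x\<close>.\<close>

lemma dependent_logs:
  assumes \<omega>: "\<omega> \<in> X" and form: "form \<noteq> 0"
    and indep: "\<And>c :: complex \<Rightarrow> int. exp (\<Sum>x\<in>X - {\<omega>}. of_int (c x) * x) = 1 \<Longrightarrow> \<forall>x\<in>X - {\<omega>}. c x = 0"
  shows False
proof -
  have "eventually (\<lambda>N :: nat. real N ^ final_const < 2 ^ N) at_top" by real_asymp
  then have "eventually (\<lambda>N :: nat. real N ^ final_const < 2 ^ N \<and> 5 \<le> N \<and> A \<le> N \<and> 2 * card V * (steps + 2) ^ n \<le> N) at_top"
    by (intro eventually_conj eventually_ge_at_top)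
  then obtain N :: nat where N: "real N ^ final_const < 2 ^ N" "5 \<le> N" "A \<le> N" "2 * card V * (steps + 2) ^ n \<le> N"
    by (auto simp: eventually_at_top_linorder)
  have "real (N ^ final_const) < real (2 ^ N)" using N(1) by simp
  then have N': "N ^ final_const < 2 ^ N" by (simp only: of_nat_less_iff)
  define L where "L = N ^ deg_exp"
  obtain p where p: "\<exists>u\<in>index L. p u \<noteq> 0"
    "\<And>u. u \<in> index L \<Longrightarrow> \<bar>p u\<bar> \<le> int (N ^ (coeff_const * N ^ ord_exp))"
    "\<And>m l. sum m X \<le> (steps + 1) * N ^ ord_exp \<Longrightarrow> 1 \<le> l \<Longrightarrow> l \<le> N \<Longrightarrow> aux L p m (of_nat l) = 0"
    using exists_aux[OF N(2-4)] unfolding L_def by blast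
  have "p u = 0" if "u \<in> index L" for u
  proof (rule aux_eq_0_imp_coeff_eq_0[OF \<omega> form indep _ that])
    fix m l assume m: "sum m X \<le> L" and l: "1 \<le> l" "l \<le> (L + 1) ^ n"
    show "aux L p m (of_nat l) = 0"
      unfolding L_def
    proof (rule extrapolation[OF N(2,3) N' _ _ order.refl _ l(1)])
      have "L \<le> N ^ ord_exp" unfolding L_def using N(2) by (intro power_increasing) (auto simp: deg_exp_def ord_exp_def)
      then show "sum m X \<le> (steps + 1 - steps) * N ^ ord_exp" using m by simp
      have "(L + 1) ^ n \<le> (N ^ (deg_exp + 1)) ^ n"
        unfolding L_def using size_bounds(1)[OF N(2,3), of 0 0] by (intro power_mono) auto
      also have "\<dots> = N ^ steps" unfolding power_mult[symmetric] by (simp add: steps_def deg_exp_def numeral_eq_Suc)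
      also have "\<dots> \<le> N ^ (steps + 1)" using N(2) by (intro power_increasing) auto
      finally show "l \<le> N ^ (steps + 1)" using l(2) by linarith
    qed (use p in \<open>auto simp: L_def\<close>)
  qed simp_all
  with p(1) show False by blast
qed

end

subsection \<open>Baker's theorem and Gauss' formula\<close>

lemma common_multiplier_algebraic_int:
  fixes \<Theta> :: "'a :: field_char_0 set"
  assumes "finite \<Theta>" "\<And>\<theta>. \<theta> \<in> \<Theta> \<Longrightarrow> algebraic \<theta>"
  shows "\<exists>c :: int. c \<noteq> 0 \<and> (\<forall>\<theta>\<in>\<Theta>. algebraic_int (of_int c * \<theta>))"
  using assms
proof (induction \<Theta> rule: finite_induct)
  case empty
  show ?case by (intro exI[of _ 1]) simp
next
  case (insert \<theta> \<Theta>)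
  then obtain c :: int where c: "c \<noteq> 0" "\<And>\<eta>. \<eta> \<in> \<Theta> \<Longrightarrow> algebraic_int (of_int c * \<eta>)" by auto
  have "algebraic \<theta>" using insert.prems by simp
  then obtain d :: int where d: "d \<noteq> 0" "algebraic_int (of_int d * \<theta>)" by (rule algebraic_imp_multiple_algebraic_int)
  have "algebraic_int (of_int (c * d) * \<eta>)" if "\<eta> \<in> insert \<theta> \<Theta>" for \<eta>
  proof (cases "\<eta> = \<theta>")
    case True
    then show ?thesis using algebraic_int_of_int_mult[OF d(2), of c] by (simp add: mult.assoc)
  next
    case False
    then show ?thesis using algebraic_int_of_int_mult[OF c(2)[of \<eta>], of d] that by (simp add: mult_ac)
  qed
  then show ?case using c(1) d(1) by (intro exI[of _ "c * d"]) simp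
qed

text \<open>Multiplying by one integer makes all coefficients and the value of the form algebraic
  integers, so that a single module carries them together with the \<open>exp x\<close>.\<close>

lemma baker_independent:
  fixes X :: "complex set" and \<beta> :: "complex \<Rightarrow> complex"
  assumes X: "finite X" "2 * of_real pi * \<i> \<in> X" "\<And>x. x \<in> X \<Longrightarrow> algebraic_int (exp x)"
    and \<beta>: "\<And>x. x \<in> X \<Longrightarrow> algebraic (\<beta> x)" and alg: "algebraic (\<Sum>x\<in>X. \<beta> x * x)"
    and indep: "\<And>c :: complex \<Rightarrow> int. exp (\<Sum>x\<in>X - {2 * of_real pi * \<i>}. of_int (c x) * x) = 1 \<Longrightarrow>
      \<forall>x\<in>X - {2 * of_real pi * \<i>}. c x = 0"
  shows "(\<Sum>x\<in>X. \<beta> x * x) = 0"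
proof (rule ccontr)
  assume nz: "(\<Sum>x\<in>X. \<beta> x * x) \<noteq> 0"
  have "\<exists>c :: int. c \<noteq> 0 \<and> (\<forall>\<theta>\<in>insert (\<Sum>x\<in>X. \<beta> x * x) (\<beta> ` X). algebraic_int (of_int c * \<theta>))"
    using X(1) \<beta> alg by (intro common_multiplier_algebraic_int) auto
  then obtain c :: int where c: "c \<noteq> 0" "algebraic_int (of_int c * (\<Sum>x\<in>X. \<beta> x * x))"
    "\<And>x. x \<in> X \<Longrightarrow> algebraic_int (of_int c * \<beta> x)" by auto
  define \<beta>' where "\<beta>' x = of_int c * \<beta> x" for x
  have form: "(\<Sum>x\<in>X. \<beta>' x * x) = of_int c * (\<Sum>x\<in>X. \<beta> x * x)"
    by (simp add: \<beta>'_def sum_distrib_left mult.assoc)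
  define \<Theta> where "\<Theta> = insert (\<Sum>x\<in>X. \<beta>' x * x) (\<beta>' ` X \<union> exp ` X)"
  have fin: "finite \<Theta>" using X(1) by (simp add: \<Theta>_def)
  have "\<exists>V. finite V \<and> 1 \<in> V \<and> (\<forall>\<theta>\<in>\<Theta>. \<exists>b. zrep V b \<theta>)"
  proof (rule exists_zrep_module[OF fin])
    show "algebraic_int \<theta>" if "\<theta> \<in> \<Theta>" for \<theta>
      using that X(3) c unfolding \<Theta>_def form by (auto simp: \<beta>'_def)
  qed
  then obtain V b where V: "finite V" "1 \<in> V" and b: "\<And>\<theta>. \<theta> \<in> \<Theta> \<Longrightarrow> zrep V (b \<theta>) \<theta>" by metis
  define A where "A = 1 + (\<Sum>\<theta>\<in>\<Theta>. b \<theta>) + (\<Sum>x\<in>X. nat \<lceil>norm x\<rceil>)"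
  have rep: "zrep V A \<theta>" if "\<theta> \<in> \<Theta>" for \<theta>
    using b[OF that] by (rule zrep_mono) (use member_le_sum[of \<theta> \<Theta> b] that fin in \<open>simp add: A_def\<close>)
  have norm: "norm x \<le> real A" if "x \<in> X" for x
  proof -
    have "norm x \<le> real (nat \<lceil>norm x\<rceil>)" by linarith
    also have "\<dots> \<le> real A"
      unfolding of_nat_le_iff A_def using that X(1) by (intro trans_le_add2 member_le_sum) auto
    finally show ?thesis .
  qed
  interpret log_linear_form X V \<beta>' A
    by unfold_locales (use X(1) V rep norm in \<open>auto simp: \<Theta>_def A_def\<close>)
  show False
    by (rule dependent_logs[OF X(2) _ indep]) (use nz c in \<open>simp_all add: form_def form\<close>)
qed

text \<open>A multiplicative relation between the \<open>exp x\<close> is, after taking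
  logarithms, a linear relation between the \<open>x\<close> and \<open>2 \<pi> \<i>\<close>, which lets one eliminate an \<open>x\<close>
  from the form.\<close>

lemma baker_aux:
  fixes X :: "complex set" and \<beta> :: "complex \<Rightarrow> complex"
  assumes "finite X" "2 * of_real pi * \<i> \<notin> X" "\<And>x. x \<in> X \<Longrightarrow> algebraic_int (exp x)"
    and "\<And>x. x \<in> X \<Longrightarrow> algebraic (\<beta> x)" "algebraic b0"
    and "algebraic (b0 * (2 * of_real pi * \<i>) + (\<Sum>x\<in>X. \<beta> x * x))"
  shows "b0 * (2 * of_real pi * \<i>) + (\<Sum>x\<in>X. \<beta> x * x) = 0"
  using assms
proof (induction "card X" arbitrary: X \<beta> b0 rule: less_induct)
  case less
  let ?\<omega> = "2 * of_real pi * \<i> :: complex"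
  show ?case
  proof (cases "\<forall>c :: complex \<Rightarrow> int. exp (\<Sum>x\<in>X. of_int (c x) * x) = 1 \<longrightarrow> (\<forall>x\<in>X. c x = 0)")
    \<comment> \<open>For empty \<open>X\<close> independence is vacuous, and the claim is in
      essence the transcendence of \<pi>.\<close>
    case True
    have diff: "insert ?\<omega> X - {?\<omega>} = X" using less.prems(2) by auto
    have sum: "(\<Sum>x\<in>insert ?\<omega> X. (\<beta>(?\<omega> := b0)) x * x) = b0 * ?\<omega> + (\<Sum>x\<in>X. \<beta> x * x)"
    proof -
      have "(\<Sum>x\<in>X. (\<beta>(?\<omega> := b0)) x * x) = (\<Sum>x\<in>X. \<beta> x * x)"
        using less.prems(2) by (intro sum.cong) auto
      then show ?thesis using less.prems(1,2) by simp
    qed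
    have "exp ?\<omega> = 1" by (rule exp_two_pi_i)
    then have "algebraic_int (exp ?\<omega>)" by simp
    then have "(\<Sum>x\<in>insert ?\<omega> X. (\<beta>(?\<omega> := b0)) x * x) = 0"
      using less.prems True by (intro baker_independent) (auto simp: sum diff simp del: fun_upd_apply, auto)
    then show ?thesis by (simp only: sum)
  next
    case False
    then obtain c :: "complex \<Rightarrow> int" and y where c: "exp (\<Sum>x\<in>X. of_int (c x) * x) = 1" "y \<in> X" "c y \<noteq> 0" by auto
    from c(1) obtain k :: int where k: "Re (\<Sum>x\<in>X. of_int (c x) * x) = 0" "Im (\<Sum>x\<in>X. of_int (c x) * x) = of_int (2 * k) * pi"
      unfolding exp_eq_1 by blast
    have "(\<Sum>x\<in>X. of_int (c x) * x) = of_int k * ?\<omega>"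
      by (rule complex_eqI) (use k in simp_all)
    then have rel: "of_int (c y) * y + (\<Sum>x\<in>X - {y}. of_int (c x) * x) = of_int k * ?\<omega>"
      using c(2) less.prems(1) by (simp add: sum.remove[of X y])
    \<comment> \<open>Solving the relation for \<open>y\<close> changes the remaining coefficients
      by rational multiples of \<open>\<beta> y\<close>, so they stay algebraic.\<close>
    define \<beta>' where "\<beta>' x = \<beta> x - \<beta> y * (of_int (c x) / of_int (c y))" for x
    define b0' where "b0' = b0 + \<beta> y * (of_int k / of_int (c y))"
    have rat: "algebraic (of_int i / of_int j :: complex)" for i j by (intro rat_imp_algebraic Rats_divide Rats_of_int)
    have "y = (of_int k / of_int (c y)) * ?\<omega> - (\<Sum>x\<in>X - {y}. of_int (c x) / of_int (c y) * x)"
      using rel c(3) by (simp add: field_simps sum_divide_distrib[symmetric])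
    then have "\<beta> y * y = \<beta> y * ((of_int k / of_int (c y)) * ?\<omega> - (\<Sum>x\<in>X - {y}. of_int (c x) / of_int (c y) * x))"
      by simp
    then have eq: "b0 * ?\<omega> + (\<Sum>x\<in>X. \<beta> x * x) = b0' * ?\<omega> + (\<Sum>x\<in>X - {y}. \<beta>' x * x)"
      using c(2) less.prems(1)
      by (simp add: sum.remove[of X y] \<beta>'_def b0'_def algebra_simps sum_subtractf sum_distrib_left)
    have "card (X - {y}) < card X" using c(2) less.prems(1) by (intro psubset_card_mono) auto
    then have "b0' * ?\<omega> + (\<Sum>x\<in>X - {y}. \<beta>' x * x) = 0"
    proof (rule less.hyps)
      show "algebraic (\<beta>' x)" if "x \<in> X - {y}" for x
        unfolding \<beta>'_def using that c(2) less.prems(4) by (intro algebraic_diff algebraic_mult rat) auto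
      show "algebraic b0'"
        unfolding b0'_def using c(2) less.prems(4,5) by (intro algebraic_add algebraic_mult rat) auto
      show "algebraic (b0' * ?\<omega> + (\<Sum>x\<in>X - {y}. \<beta>' x * x))" using less.prems(6) by (simp only: eq)
    qed (use less.prems in auto)
    then show ?thesis by (simp only: eq)
  qed
qed

theorem baker:
  fixes X :: "complex set" and \<beta> :: "complex \<Rightarrow> complex"
  assumes X: "finite X" "\<And>x. x \<in> X \<Longrightarrow> algebraic_int (exp x)"
    and \<beta>: "\<And>x. x \<in> X \<Longrightarrow> algebraic (\<beta> x)" and alg: "algebraic (\<Sum>x\<in>X. \<beta> x * x)"
  shows "(\<Sum>x\<in>X. \<beta> x * x) = 0"
proof -
  let ?\<omega> = "2 * of_real pi * \<i> :: complex"
  define b0 where "b0 = (if ?\<omega> \<in> X then \<beta> ?\<omega> else 0)"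
  have eq: "(\<Sum>x\<in>X. \<beta> x * x) = b0 * ?\<omega> + (\<Sum>x\<in>X - {?\<omega>}. \<beta> x * x)"
    using X(1) by (cases "?\<omega> \<in> X") (simp_all add: b0_def sum.remove)
  show ?thesis
    unfolding eq by (rule baker_aux) (use X \<beta> alg[unfolded eq] in \<open>auto simp: b0_def\<close>)
qed

text \<open>The \<open>x\<close> are arbitrary logarithms, not principal values, so closure under
  addition involves no choice of branch.\<close>

definition alg_log_comb :: "complex \<Rightarrow> bool" where
  "alg_log_comb z \<longleftrightarrow> (\<exists>X \<beta>. finite X \<and> (\<forall>x\<in>X. algebraic_int (exp x) \<and> algebraic (\<beta> x)) \<and> z = (\<Sum>x\<in>X. \<beta> x * x))"

lemma alg_log_comb_algebraic_imp_0: "alg_log_comb z \<Longrightarrow> algebraic z \<Longrightarrow> z = 0"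
  unfolding alg_log_comb_def using baker by blast

lemma alg_log_comb_log: "algebraic b \<Longrightarrow> algebraic_int (exp x) \<Longrightarrow> alg_log_comb (b * x)"
  unfolding alg_log_comb_def by (intro exI[of _ "{x}"] exI[of _ "\<lambda>_. b"]) simp

lemma alg_log_comb_0: "alg_log_comb 0"
  unfolding alg_log_comb_def by (intro exI[of _ "{}"]) simp

lemma alg_log_comb_add:
  assumes "alg_log_comb y" "alg_log_comb z" shows "alg_log_comb (y + z)"
proof -
  obtain X \<beta> where X: "finite X" "\<And>x. x \<in> X \<Longrightarrow> algebraic_int (exp x) \<and> algebraic (\<beta> x)" "y = (\<Sum>x\<in>X. \<beta> x * x)"
    using assms(1) unfolding alg_log_comb_def by blast
  obtain Y \<gamma> where Y: "finite Y" "\<And>x. x \<in> Y \<Longrightarrow> algebraic_int (exp x) \<and> algebraic (\<gamma> x)" "z = (\<Sum>x\<in>Y. \<gamma> x * x)"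
    using assms(2) unfolding alg_log_comb_def by blast
  define \<delta> where "\<delta> x = (if x \<in> X then \<beta> x else 0) + (if x \<in> Y then \<gamma> x else 0)" for x
  have "(\<Sum>x\<in>X. \<beta> x * x) = (\<Sum>x\<in>X \<union> Y. (if x \<in> X then \<beta> x else 0) * x)"
    using X(1) Y(1) by (intro sum.mono_neutral_cong_left) auto
  moreover have "(\<Sum>x\<in>Y. \<gamma> x * x) = (\<Sum>x\<in>X \<union> Y. (if x \<in> Y then \<gamma> x else 0) * x)"
    using X(1) Y(1) by (intro sum.mono_neutral_cong_left) auto
  ultimately have "y + z = (\<Sum>x\<in>X \<union> Y. \<delta> x * x)"
    by (simp add: X(3) Y(3) \<delta>_def distrib_right sum.distrib)
  moreover have "algebraic (\<delta> x)" if "x \<in> X \<union> Y" for x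
    unfolding \<delta>_def using X(2) Y(2) that by (intro algebraic_add) auto
  ultimately show ?thesis unfolding alg_log_comb_def using X Y by (intro exI[of _ "X \<union> Y"] exI[of _ \<delta>]) auto
qed

lemma alg_log_comb_uminus:
  assumes "alg_log_comb z" shows "alg_log_comb (- z)"
proof -
  obtain X \<beta> where X: "finite X" "\<And>x. x \<in> X \<Longrightarrow> algebraic_int (exp x) \<and> algebraic (\<beta> x)" "z = (\<Sum>x\<in>X. \<beta> x * x)"
    using assms unfolding alg_log_comb_def by blast
  then show ?thesis unfolding alg_log_comb_def
    by (intro exI[of _ X] exI[of _ "\<lambda>x. - \<beta> x"]) (auto simp: sum_negf)
qed

lemma alg_log_comb_sum:
  "(\<And>i. i \<in> I \<Longrightarrow> alg_log_comb (f i)) \<Longrightarrow> alg_log_comb (\<Sum>i\<in>I. f i)"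
  by (induction I rule: infinite_finite_induct) (auto intro: alg_log_comb_add alg_log_comb_0)

section \<open>Gauss' formula for digamma at rational points\<close>

lemma Re_less_1_unit_circle:
  assumes "norm w = 1" "w \<noteq> 1" shows "Re w < 1"
proof -
  have "Re w \<le> 1" using complex_Re_le_cmod[of w] assms by simp
  moreover have "Re w \<noteq> 1"
  proof
    assume "Re w = 1"
    then have "(Im w)\<^sup>2 = 0" using assms(1) cmod_power2[of w] by simp
    then show False using \<open>Re w = 1\<close> assms(2) by (simp add: complex_eq_iff)
  qed
  ultimately show ?thesis by simp
qed

text \<open>The remainder of the logarithmic series is \<open>\<integral>\<^sub>0\<^sup>1 w (w x) ^ M / (1 - w x) dx\<close>, and
  \<open>1 - w x\<close> stays away from \<open>0\<close>.\<close>

lemma Ln_series_unit_circle: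
  assumes w: "norm w = 1" "w \<noteq> 1"
  shows "(\<lambda>m. w ^ Suc m / of_nat (Suc m)) sums (- Ln (1 - w))"
proof -
  \<comment> \<open>The real part of \<open>1 - w * x\<close> is affine in \<open>x\<close>, so on
    the unit interval it is at least the smaller of its two end values.\<close>
  define c where "c = min 1 (1 - Re w)"
  have c: "c > 0" using Re_less_1_unit_circle[OF w] by (simp add: c_def)
  have Re: "c \<le> Re (1 - w * of_real x)" if "0 \<le> x" "x \<le> 1" for x
  proof (cases "Re w \<le> 0")
    case True
    then show ?thesis using that by (simp add: c_def mult_nonpos_nonneg min.coboundedI1)
  next
    case False
    then show ?thesis using that mult_left_mono[of x 1 "Re w"] by (simp add: c_def)
  qed
  define G where "G M u = (\<Sum>m<M. (w * u) ^ Suc m / of_nat (Suc m)) + Ln (1 - w * u)" for M u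
  define g where "g M x = - (w * (w * of_real x) ^ M / (1 - w * of_real x))" for M and x :: real
  have bound: "norm (G M 1) \<le> 1 / c * (1 / real (Suc M))" for M
  proof -
    have deriv: "((\<lambda>x. G M (of_real x)) has_vector_derivative g M x) (at x within {0..1})" if x: "x \<in> {0..1}" for x
    proof -
      let ?u = "w * of_real x"
      have pos: "Re (1 - ?u) > 0" using Re[of x] x c by simp
      then have ne: "?u \<noteq> 1" by (metis diff_self less_irrefl zero_complex.sel(1))
      have "(G M has_field_derivative (\<Sum>m<M. ?u ^ m * w) - w / (1 - ?u)) (at (of_real x))"
      proof -
        have "((\<lambda>u. (w * u) ^ Suc m / of_nat (Suc m)) has_field_derivative ?u ^ m * w) (at (of_real x))" for m
        proof -
          have "((\<lambda>u. (w * u) ^ Suc m / of_nat (Suc m)) has_field_derivative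
              of_nat (Suc m) * ?u ^ m * w / of_nat (Suc m)) (at (of_real x))"
            by (rule derivative_eq_intros refl | simp del: of_nat_Suc power_Suc)+
          then show ?thesis by (simp del: of_nat_Suc power_Suc)
        qed
        moreover have "((\<lambda>u. Ln (1 - w * u)) has_field_derivative - (w / (1 - ?u))) (at (of_real x))"
          using pos ne by (auto intro!: derivative_eq_intros simp: complex_nonpos_Reals_iff divide_inverse mult.commute)
        ultimately show ?thesis
          unfolding G_def diff_conv_add_uminus by (intro DERIV_add DERIV_sum)
      qed
      also have "(\<Sum>m<M. ?u ^ m * w) - w / (1 - ?u) = g M x"
      proof -
        have "(1 - P) / v * w - w / v = - (w * P / v)" for P v :: complex
          by (cases "v = 0") (auto simp: field_simps)
        then show ?thesis unfolding sum_distrib_right[symmetric] sum_gp_strict g_def using ne by simp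
      qed
      finally show ?thesis by (rule has_vector_derivative_real_field)
    qed
    have int1: "(g M has_integral (G M (of_real 1) - G M (of_real 0))) {0..1}"
      by (rule fundamental_theorem_of_calculus[OF _ deriv]) auto
    have int2: "((\<lambda>x. 1 / c * x ^ M) has_integral (1 / c * (1 ^ Suc M / real (Suc M) - 0 ^ Suc M / real (Suc M)))) {0..1}"
    proof (intro has_integral_mult_right fundamental_theorem_of_calculus)
      show "((\<lambda>x. x ^ Suc M / real (Suc M)) has_vector_derivative x ^ M) (at x within {0..1})" for x :: real
        unfolding has_real_derivative_iff_has_vector_derivative[symmetric]
        by (auto intro!: derivative_eq_intros simp del: power_Suc)
    qed simp
    have "norm (integral {0..1} (g M)) \<le> integral {0..1} (\<lambda>x. 1 / c * x ^ M)"
    proof (rule integral_norm_bound_integral)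
      fix x :: real assume x: "x \<in> {0..1}"
      have "c \<le> norm (1 - w * of_real x)" using Re[of x] complex_Re_le_cmod[of "1 - w * of_real x"] x by simp
      then have "x ^ M / norm (1 - w * of_real x) \<le> x ^ M / c" using c x by (intro divide_left_mono) (auto intro!: mult_pos_pos)
      then show "norm (g M x) \<le> 1 / c * x ^ M"
        using x w by (simp add: g_def norm_mult norm_divide norm_power)
    qed (use int1 int2 in \<open>blast+\<close>)
    then show ?thesis using integral_unique[OF int1] integral_unique[OF int2] by (simp add: G_def)
  qed
  have "(\<lambda>M. G M 1) \<longlonglongrightarrow> 0"
  proof (rule Lim_null_comparison[OF always_eventually])
    show "\<forall>M. norm (G M 1) \<le> 1 / c * (1 / real (Suc M))" using bound by blast
    show "(\<lambda>M. 1 / c * (1 / real (Suc M))) \<longlonglongrightarrow> 0"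
      by real_asymp
  qed
  then have "(\<lambda>M. G M 1 - Ln (1 - w)) \<longlonglongrightarrow> 0 - Ln (1 - w)" by (intro tendsto_intros)
  then show ?thesis by (simp add: sums_def G_def)
qed

lemma sum_powers_root_of_unity:
  fixes n j :: nat
  assumes "n > 0"
  defines "w \<equiv> exp (2 * of_real pi * \<i> / of_nat n) :: complex"
  shows "(\<Sum>t<n. (w ^ t) ^ j) = (if n dvd j then of_nat n else 0)"
proof -
  have w1: "w ^ j = 1 \<longleftrightarrow> n dvd j" for j
    using complex_root_unity_eq_1[of n j] assms by (simp add: w_def exp_of_nat_mult[symmetric] mult_ac)
  have "(\<Sum>t<n. (w ^ t) ^ j) = (\<Sum>t<n. (w ^ j) ^ t)" by (simp add: power_mult[symmetric] mult.commute)
  also have "\<dots> = (if n dvd j then of_nat n else 0)"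
  proof (cases "n dvd j")
    case True
    then have "w ^ j = 1" by (simp add: w1)
    then show ?thesis using True by simp
  next
    case False
    moreover have "(w ^ j) ^ n = 1" unfolding power_mult[symmetric] w1 by simp
    ultimately show ?thesis using w1[of j] by (simp add: sum_gp_strict)
  qed
  finally show ?thesis .
qed

text \<open>The formula is kept in complex form, as a finite Fourier sum of the series for
  \<open>- Ln (1 - w ^ t)\<close>. The weights select the residue class of \<open>r\<close> and
  subtract that of 0, which leaves the terms \<open>n / (k * n + r) - n / (k * n + n)\<close> of the
  digamma series.\<close>

theorem gauss_digamma:
  fixes n r :: nat
  assumes r: "1 \<le> r" "r < n"
  defines "w \<equiv> exp (2 * of_real pi * \<i> / of_nat n) :: complex"
  shows "of_real (Digamma (real r / real n) + euler_mascheroni) = (\<Sum>t=1..<n. ((w ^ t) ^ (n - r) - 1) * Ln (1 - w ^ t))"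
proof -
  have n: "n > 0" using r by simp
  have norm: "norm (w ^ t) = 1" for t by (simp add: w_def norm_power)
  have ne: "w ^ t \<noteq> 1" if "t \<in> {1..<n}" for t
    using complex_root_unity_eq_1[of n t] that by (auto simp: w_def exp_of_nat_mult[symmetric] mult_ac dest: dvd_imp_le)
  \<comment> \<open>The exponent \<open>n - r\<close> replaces -r. The index \<open>t = 0\<close>,
    needed for orthogonality, is harmless since its weight is 0.\<close>
  define d where "d m = (\<Sum>t<n. ((w ^ t) ^ (n - r) - 1) * (w ^ t) ^ m)" for m
  have d: "d m = (if n dvd m + n - r then of_nat n else 0) - (if n dvd m then of_nat n else 0)" for m
  proof -
    have "d m = (\<Sum>t<n. (w ^ t) ^ (m + n - r)) - (\<Sum>t<n. (w ^ t) ^ m)"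
      using r by (simp add: d_def algebra_simps sum_subtractf power_add[symmetric])
    then show ?thesis using sum_powers_root_of_unity[OF n] by (simp add: w_def)
  qed
  have "(\<lambda>m. \<Sum>t=1..<n. ((w ^ t) ^ (n - r) - 1) * ((w ^ t) ^ Suc m / of_nat (Suc m))) sums
      (\<Sum>t=1..<n. ((w ^ t) ^ (n - r) - 1) * (- Ln (1 - w ^ t)))"
    by (intro sums_sum sums_mult Ln_series_unit_circle norm ne) auto
  also have "(\<lambda>m. \<Sum>t=1..<n. ((w ^ t) ^ (n - r) - 1) * ((w ^ t) ^ Suc m / of_nat (Suc m))) = (\<lambda>m. d (Suc m) / of_nat (Suc m))"
  proof
    fix m
    have "d (Suc m) = (\<Sum>t=1..<n. ((w ^ t) ^ (n - r) - 1) * (w ^ t) ^ Suc m)"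
      unfolding d_def by (intro sum.mono_neutral_right) (auto simp: not_less_eq_eq)
    then show "(\<Sum>t=1..<n. ((w ^ t) ^ (n - r) - 1) * ((w ^ t) ^ Suc m / of_nat (Suc m))) = d (Suc m) / of_nat (Suc m)"
      by (simp only: sum_divide_distrib times_divide_eq_right)
  qed
  \<comment> \<open>Summing consecutive blocks of length \<open>n\<close> preserves the sum of a
    convergent series; each block contains exactly one index of either residue class.\<close>
  finally have "(\<lambda>k. \<Sum>m\<in>{k * n..<k * n + n}. d (Suc m) / of_nat (Suc m)) sums
      (\<Sum>t=1..<n. ((w ^ t) ^ (n - r) - 1) * (- Ln (1 - w ^ t)))"
    using n by (rule sums_group)
  moreover have "(\<Sum>m\<in>{k * n..<k * n + n}. d (Suc m) / of_nat (Suc m)) =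
      - of_real (inverse (real (Suc k)) - inverse (real r / real n + real k))" for k
  proof -
    have "(\<Sum>m\<in>{k * n..<k * n + n}. d (Suc m) / of_nat (Suc m)) = (\<Sum>i<n. d (Suc (k * n + i)) / of_nat (Suc (k * n + i)))"
      using sum.shift_bounds_nat_ivl[of "\<lambda>m. d (Suc m) / of_nat (Suc m)" 0 "k * n" n]
      by (simp add: add.commute lessThan_atLeast0)
    also have "\<dots> = (\<Sum>i<n. (if i = r - 1 then of_nat n / of_nat (Suc (k * n + i)) else 0)
        - (if i = n - 1 then of_nat n / of_nat (Suc (k * n + i)) else 0))"
    proof (intro sum.cong refl)
      fix i assume i: "i \<in> {..<n}"
      have "n dvd Suc (k * n + i) \<longleftrightarrow> n dvd Suc i" using dvd_add_right_iff[of n "k * n" "Suc i"] by simp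
      also have "\<dots> \<longleftrightarrow> i = n - 1" using i dvd_imp_le[of n "Suc i"] by auto
      finally have 1: "n dvd Suc (k * n + i) \<longleftrightarrow> i = n - 1" .
      have "Suc (k * n + i) + n - r = k * n + (Suc i + n - r)" using r by simp
      then have "n dvd Suc (k * n + i) + n - r \<longleftrightarrow> n dvd Suc i + n - r"
        using dvd_add_right_iff[of n "k * n" "Suc i + n - r"] by simp
      also have "\<dots> \<longleftrightarrow> i = r - 1"
      proof
        assume "n dvd Suc i + n - r"
        then obtain q where q: "Suc i + n - r = n * q" by (elim dvdE)
        have "0 < Suc i + n - r" "Suc i + n - r < n * 2" using i r by auto
        then have "0 < n * q" "n * q < n * 2" unfolding q .
        then have "q = 1" by (cases q) auto
        then show "i = r - 1" using q r by simp
      qed (use r in simp)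
      finally show "d (Suc (k * n + i)) / of_nat (Suc (k * n + i)) = (if i = r - 1 then of_nat n / of_nat (Suc (k * n + i)) else 0)
        - (if i = n - 1 then of_nat n / of_nat (Suc (k * n + i)) else 0)"
        using 1 by (simp add: d del: of_nat_Suc)
    qed
    also have "\<dots> = of_nat n / of_nat (Suc (k * n + (r - 1))) - of_nat n / of_nat (Suc (k * n + (n - 1)))"
      using r by (simp add: sum_subtractf)
    also have "Suc (k * n + (r - 1)) = k * n + r" using r by simp
    also have "Suc (k * n + (n - 1)) = n * Suc k" using r by simp
    also have "of_nat n / of_nat (k * n + r) - of_nat n / of_nat (n * Suc k) =
        (of_real (real n / real (k * n + r) - real n / real (n * Suc k)) :: complex)" by simp
    also have "real n / real (k * n + r) - real n / real (n * Suc k) = - (inverse (real (Suc k)) - inverse (real r / real n + real k))"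
    proof -
      have "real n / real (n * Suc k) = inverse (real (Suc k))"
        unfolding of_nat_mult using n by (simp add: inverse_eq_divide del: of_nat_Suc)
      moreover have "real n / real (k * n + r) = inverse (real r / real n + real k)"
        using n r by (simp add: field_simps)
      ultimately show ?thesis by simp
    qed
    finally show ?thesis by simp
  qed
  ultimately have 1: "(\<lambda>k. - of_real (inverse (real (Suc k)) - inverse (real r / real n + real k))) sums
      (\<Sum>t=1..<n. ((w ^ t) ^ (n - r) - 1) * (- Ln (1 - w ^ t)))" by simp
  have "(\<lambda>k. inverse (real (Suc k)) - inverse (real r / real n + real k)) sums (Digamma (real r / real n) + euler_mascheroni)"
    using summable_Digamma[of "real r / real n"] n r by (simp add: Digamma_def summable_sums)
  then have "(\<lambda>k. - of_real (inverse (real (Suc k)) - inverse (real r / real n + real k)) :: complex) sums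
      (- of_real (Digamma (real r / real n) + euler_mascheroni))"
    by (intro sums_minus sums_of_real)
  from sums_unique2[OF this 1] show ?thesis
    by (simp only: mult_minus_right sum_negf neg_equal_iff_equal)
qed

text \<open>The monic integer polynomial (X - 1)^n takes the integral value (-z)^n = (-1)^n at 1 -
  z.\<close>

lemma algebraic_int_1_minus_root_of_unity:
  fixes z :: "'a :: field_char_0"
  assumes "z ^ n = 1" "n > 0" shows "algebraic_int (1 - z)"
proof (rule algebraic_int_root)
  show "algebraic_int ((-1 :: 'a) ^ n)" by (cases "even n") auto
  show "poly ([:-1, 1:] ^ n) (1 - z) = (-1) ^ n"
    using assms(1) by (simp add: power_minus[of z n])
  have "coeff ([:-1, 1:] ^ n) i = (of_int (of_nat (n choose i) * (-1) ^ (n - i)) :: 'a)" if "i \<le> n" for i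
    using that by (simp add: coeff_linear_poly_power)
  moreover have "coeff ([:-1, 1:] ^ n) i = (0 :: 'a)" if "\<not> i \<le> n" for i
    using that by (intro coeff_eq_0) (simp add: degree_linear_power)
  ultimately show "\<forall>i. coeff ([:-1, 1:] ^ n) i \<in> (\<int> :: 'a set)" by (metis Ints_0 Ints_of_int)
  show "lead_coeff ([:-1, 1:] ^ n :: 'a poly) = 1" by (simp add: lead_coeff_power)
  show "degree ([:-1, 1:] ^ n :: 'a poly) > 0" using assms(2) by (simp add: degree_linear_power)
qed

lemma alg_log_comb_digamma:
  assumes r: "1 \<le> r" "r < n"
  shows "alg_log_comb (of_real (Digamma (real r / real n) + euler_mascheroni))"
proof -
  define w where "w = (exp (2 * of_real pi * \<i> / of_nat n) :: complex)"
  have w1: "w ^ j = 1 \<longleftrightarrow> n dvd j" for j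
    using complex_root_unity_eq_1[of n j] r by (simp add: w_def exp_of_nat_mult[symmetric] mult_ac)
  have root: "(w ^ t) ^ n = 1" for t unfolding power_mult[symmetric] w1 by simp
  have "algebraic (w ^ t)" for t
  proof -
    have "algebraic_int (1 - w ^ t)" using algebraic_int_1_minus_root_of_unity[OF root] r by simp
    then have "algebraic (1 - (1 - w ^ t))" by (intro algebraic_diff[OF algebraic_1] algebraic_int_imp_algebraic)
    then show ?thesis by simp
  qed
  note alg = this
  have "alg_log_comb (((w ^ t) ^ (n - r) - 1) * Ln (1 - w ^ t))" if t: "t \<in> {1..<n}" for t
  proof (rule alg_log_comb_log)
    show "algebraic ((w ^ t) ^ (n - r) - 1)"
      unfolding power_mult[symmetric] by (intro algebraic_diff alg) auto
    have "w ^ t \<noteq> 1" using t by (auto simp: w1 dest: dvd_imp_le)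
    then show "algebraic_int (exp (Ln (1 - w ^ t)))"
      using algebraic_int_1_minus_root_of_unity[OF root] r by simp
  qed
  then show ?thesis unfolding gauss_digamma[OF r] w_def[symmetric] by (rule alg_log_comb_sum)
qed

section \<open>Algebraic values among Euler's constant and the digamma numbers\<close>

lemma transcendental_digamma_diff:
  assumes "1 \<le> r" "r < n" "1 \<le> s" "s < m" "Digamma (real r / real n) \<noteq> Digamma (real s / real m)"
    "algebraic (Digamma (real r / real n))"
  shows "\<not> algebraic (Digamma (real s / real m))"
proof
  assume "algebraic (Digamma (real s / real m))"
  let ?z = "of_real (Digamma (real r / real n)) - of_real (Digamma (real s / real m)) :: complex"
  have "algebraic ?z" by (intro algebraic_diff algebraic_of_real assms(6)) fact
  moreover have "alg_log_comb ?z"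
    using alg_log_comb_add[OF alg_log_comb_digamma[OF assms(1,2)] alg_log_comb_uminus[OF alg_log_comb_digamma[OF assms(3,4)]]]
    by simp
  ultimately have "?z = 0" by (intro alg_log_comb_algebraic_imp_0)
  then show False using assms(5) by simp
qed

lemma transcendental_digamma_euler:
  assumes "1 \<le> r" "r < n" "algebraic (euler_mascheroni :: real)"
  shows "\<not> algebraic (Digamma (real r / real n))"
proof
  assume "algebraic (Digamma (real r / real n))"
  then have "algebraic (of_real (Digamma (real r / real n)) + of_real euler_mascheroni :: complex)"
    using assms by (intro algebraic_add algebraic_of_real)
  then have "(of_real (Digamma (real r / real n) + euler_mascheroni) :: complex) = 0"
    using alg_log_comb_digamma[OF assms(1,2)] by (intro alg_log_comb_algebraic_imp_0) auto
  then have "Digamma (real r / real n) = Digamma 1" by (simp only: of_real_eq_0_iff) simp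
  moreover have "Digamma (real r / real n) < Digamma 1"
    using assms by (intro Digamma_real_strict_mono) auto
  ultimately show False by simp
qed

theorem theorem1p2:
  shows "infinite gamma_digamma_values \<and>
         (\<exists>\<^sub>\<le>\<^sub>1 x. x \<in> gamma_digamma_values \<and> algebraic x)"
proof
  \<comment> \<open>The fractions \<open>1 / (k + 2)\<close> already give infinitely many members,
    since digamma is strictly increasing on the positive reals.\<close>
  have "inj (\<lambda>k. Digamma (real 1 / real (k + 2)))"
  proof (rule linorder_inj_onI')
    fix i j :: nat assume "i < j"
    then have "Digamma (real 1 / real (j + 2)) < Digamma (real 1 / real (i + 2))"
      by (intro Digamma_real_strict_mono) (auto simp: field_simps)
    then show "Digamma (real 1 / real (i + 2)) \<noteq> Digamma (real 1 / real (j + 2))" by simp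
  qed
  moreover have "range (\<lambda>k. Digamma (real 1 / real (k + 2))) \<subseteq> gamma_digamma_values"
  proof
    fix x assume "x \<in> range (\<lambda>k. Digamma (real 1 / real (k + 2)))"
    then obtain k where "x = Digamma (real 1 / real (k + 2))" by blast
    then have "\<exists>n r. x = Digamma (real r / real n) \<and> n > 1 \<and> 1 \<le> r \<and> r < n \<and> coprime r n"
      by (intro exI[of _ "k + 2"] exI[of _ "1 :: nat"]) simp
    then show "x \<in> gamma_digamma_values" unfolding gamma_digamma_values_def by blast
  qed
  ultimately show "infinite gamma_digamma_values"
    using finite_subset range_inj_infinite by blast
  show "\<exists>\<^sub>\<le>\<^sub>1 x. x \<in> gamma_digamma_values \<and> algebraic x"
  proof (rule Uniq_I)
    fix x y assume x: "x \<in> gamma_digamma_values \<and> algebraic x" and y: "y \<in> gamma_digamma_values \<and> algebraic y"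
    have cases: "z = euler_mascheroni \<or> (\<exists>n r. z = Digamma (real r / real n) \<and> 1 \<le> r \<and> r < n)"
      if "z \<in> gamma_digamma_values" for z using that unfolding gamma_digamma_values_def by blast
    show "x = y"
      using cases[of x] cases[of y] x y transcendental_digamma_diff transcendental_digamma_euler by metis
  qed
qed

end
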